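(* Let $\mathcal M=\langle\mathcal S,\mathcal A,P,c,\gamma\rangle$ and $\hat{\mathcal M}=\langle\mathcal S,\mathcal A,\hat P,\hat c,\gamma\rangle$ be two MDPs with costs bounded below, let $w:\mathcal S\to[1,\infty)$ and $\kappa>0$ with $\gamma\kappa<1$, and let $\boldsymbol\alpha=(\alpha_1,\alpha_2)\in\mathbb R^2$ with $\alpha_1>0$. Assume: (a) both models are DP-solvable with respect to $w$; (b) $\mathcal G(V^\star)\cap\Pi_S(\kappa,w)\neq\emptyset$ and $\hat{\mathcal G}(\hat V^\star)\cap\Pi_S(\kappa,w)\cap\hat\Pi_S(\kappa,w)\neq\emptyset$; (c) for each $a\in\mathcal A$ the open-loop policy $\pi_a$ (which selects $a$ with probability one in every state) belongs to $\Pi_S(\kappa,w)\cap\hat\Pi_S(\kappa,w)$, and moreover $\mathcal G(\hat V^\star)$ and $\hat{\mathcal G}(V^\star)$ are nonempty. Let $\hat\pi^\star\in\hat{\mathcal G}(\hat V^\star)\cap\Pi_S(\kappa,w)\cap\hat\Pi_S(\kappa,w)$ (the optimal policy of $\hat{\mathcal M}$). Then the following two bounds hold: 1. (in terms of $\hat V^\star$) $$\|V^{\hat\pi^\star}-V^\star\|_w\le\frac{2}{\alpha_1(1-\gamma\kappa)}\,\mathcal D^{\max}_{\boldsymbol\alpha}\hat V^\star;$$ 2. (in terms of $V^\star$) $$\|V^{\hat\pi^\star}-V^\star\|_w\le\frac{2}{\alpha_1(1-\gamma\kappa)^2}\,\mathcal D^{\max}_{\boldsymbol\alpha}(\alpha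_1V^\star).$$
   Context: MDPs. An MDP $\mathcal M=\langle\mathcal S,\mathcal A,P,c,\gamma\rangle$ consists of Borel spaces $\mathcal S$ (states) and $\mathcal A$ (actions), a stochastic kernel $P(\cdot\mid s,a)$ from $\mathcal S\times\mathcal A$ to $\mathcal S$, a measurable per-step cost $c:\mathcal S\times\mathcal A\to\mathbb R$ bounded from below, and a discount factor $\gamma\in(0,1)$. The second MDP $\hat{\mathcal M}$ has the same $\mathcal S,\mathcal A,\gamma$ but possibly different kernel $\hat P$ and cost $\hat c$; $c_{\min}\in\mathbb R$ is a constant with $c\ge c_{\min}$ and $\hat c\ge c_{\min}$. A policy is a stochastic kernel $\pi:\mathcal S\to\Delta(\mathcal A)$ (time-homogeneous, possibly randomized), where $\Delta(\cdot)$ denotes the set of probability measures; $\Pi$ is the set of all policies. Put $c_\pi(s)=\int_{\mathcal A}c(s,a)\pi(da|s)$, $P_\pi(ds'|s)=\int_{\mathcal A}\pi(da|s)P(ds'|s,a)$. The value function of $\pi$ is $V^\pi(s)=\mathbb E^\pi\bigl[\sum_{t\ge1}\gamma^{t-1}c(S_t,A_t)\mid S_1=s\bigr]$. Function space and operators. $\mathcal V$ is the set of measurable functions $\mathcal S\to[\frac{c_{\min}}{1-\gamma},\infty)\cup\{+\infty\}$. For $w:\mathcal S\to[1,\infty)$, $\|v\|_w=\sup_{s}|v(s)|/w(s)$ (also used for differences of functions) and $\mathcal V_w=\{v\in\mathcal V:\|v\|_w<\infty\}$. Bellman operators: $[\mathcal B^\pi v](s)=c_\pi(s)+\gamma\int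 v(s')P_\pi(ds'|s)$ and $[\mathcal B^\star v](s)=\inf_{a\in\mathcal A}\{c(s,a)+\gamma\int v(s')P(ds'|s,a)\}$. The set of one-step greedy policies is $\mathcal G(v)=\{\pi\in\Pi:\mathcal B^\pi v=\mathcal B^\star v\}$. DP-solvability. $\mathcal M$ is DP-solvable with respect to $w$ if (i) $\mathcal B^\star v\in\mathcal V_w$ for all $v\in\mathcal V_w$; (ii) there is $V^\star\in\mathcal V_w$ with $V^\star(s)\le V^\pi(s)$ for all $s$ and all $\pi\in\Pi$, with equality at all states for at least one $\pi\in\Pi$; (iii) $V^\star=\mathcal B^\star V^\star$. This $V^\star$ is the optimal value function. Stability. For $\kappa>0$ with $\gamma\kappa<1$, a policy $\pi$ is $(\kappa,w)$ stable for $\mathcal M$ if $\|c_\pi\|_w<\infty$ and $\int w(s')P_\pi(ds'|s)\le\kappa w(s)$ for all $s$. $\Pi_S(\kappa,w)$ is the set of $(\kappa,w)$-stable policies for $\mathcal M$. Hats denote the corresponding objects for $\hat{\mathcal M}$: $\hat V^\pi,\hat V^\star,\hat{\mathcal B}^\pi,\hat{\mathcal B}^\star,\hat{\mathcal G}(v),\hat\Pi_S(\kappa,w)$. $V^{\hat\pi^\star}$ is the value function of $\hat\pi^\star$ in $\mathcal M$. Affine transformation. $\mathcal M_{\boldsymbol\alpha}=\langle\mathcal S,\mathcal A,P,\alpha_1c+\alpha_2,\gamma\rangle$ is the MDP with the same dynamics as $\mathcal M$ and cost $\alpha_1c+\alpha_2$; $\mathcal B^\pi_{\boldsymbol\alpha}$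 is its Bellman operator, i.e. the formula for $\mathcal B^\pi$ with $c$ replaced by $\alpha_1c+\alpha_2$. Bellman maximum mismatch functional: $\mathcal D^{\max}_{\boldsymbol\alpha}v=\sup_{a\in\mathcal A}\|\mathcal B^{\pi_a}_{\boldsymbol\alpha}v-\hat{\mathcal B}^{\pi_a}v\|_w$; the same formula is used for $v=\alpha_1V^\star$. *)

theory Defs
  imports "HOL-Probability.Probability"
begin

text \<open>
  A Borel space is a Borel subset of a Polish space: the carriers below are Borel sets in types of
  class \<^class>\<open>polish_space\<close>, with the trace of the Borel sigma-algebra. Functions on
  a carrier are HOL functions whose values outside the carrier are never inspected.
\<close>

record ('s, 'a) mdp =
  states :: "'s set"
  actions :: "'a set"
  kernel :: "'s \<times> 'a \<Rightarrow> 's measure"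
  cost :: "'s \<times> 'a \<Rightarrow> real"
  discount :: real

definition state_space :: "('s::polish_space, 'a::polish_space) mdp \<Rightarrow> 's measure" where
  "state_space M = restrict_space borel (states M)"

definition action_space :: "('s::polish_space, 'a::polish_space) mdp \<Rightarrow> 'a measure" where
  "action_space M = restrict_space borel (actions M)"

definition is_mdp :: "real \<Rightarrow> ('s::polish_space, 'a::polish_space) mdp \<Rightarrow> bool" where
  "is_mdp c_min M \<longleftrightarrow>
     states M \<in> sets borel \<and> actions M \<in> sets borel \<and>
     kernel M \<in> state_space M \<Otimes>\<^sub>M action_space M \<rightarrow>\<^sub>M prob_algebra (state_space M) \<and>
     cost M \<in> borel_measurable (state_space M \<Otimes>\<^sub>M action_space M) \<and>
     (\<forall>s\<in>states M. \<forall>a\<in>actions M. c_min \<le> cost M (s, a)) \<and>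
     0 < discount M \<and> discount M < 1"

definition policies :: "('s::polish_space, 'a::polish_space) mdp \<Rightarrow> ('s \<Rightarrow> 'a measure) set" where
  "policies M = state_space M \<rightarrow>\<^sub>M prob_algebra (action_space M)"

text \<open>
  The integral of an extended-real function, as the integral of its positive part minus that of its
  negative part. It is used only for functions bounded below and probability measures, where the
  second term is finite; the value may be \<open>\<infinity>\<close>.
\<close>

definition ext_integral :: "'x measure \<Rightarrow> ('x \<Rightarrow> ereal) \<Rightarrow> ereal" where
  "ext_integral \<mu> f =
     enn2ereal (\<integral>\<^sup>+ x. e2ennreal (f x) \<partial>\<mu>) - enn2ereal (\<integral>\<^sup>+ x. e2ennreal (- f x) \<partial>\<mu>)"

definition policy_cost ::
  "('s::polish_space, 'a::polish_space) mdp \<Rightarrow> ('s \<Rightarrow> 'a measure) \<Rightarrow> 's \<Rightarrow> ereal" where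
  "policy_cost M \<pi> s = ext_integral (\<pi> s) (\<lambda>a. ereal (cost M (s, a)))"

definition policy_kernel ::
  "('s::polish_space, 'a::polish_space) mdp \<Rightarrow> ('s \<Rightarrow> 'a measure) \<Rightarrow> 's \<Rightarrow> 's measure" where
  "policy_kernel M \<pi> s = \<pi> s \<bind> (\<lambda>a. kernel M (s, a))"

text \<open>
  The law of the process of state-action pairs under a policy, started in a fixed state, is given by
  the Ionescu-Tulcea theorem. Time is counted from \<open>0\<close>, so coordinate \<open>t\<close> of a path is
  \<open>(S\<^bsub>t+1\<^esub>, A\<^bsub>t+1\<^esub>)\<close> in the usual numbering from \<open>1\<close>.
\<close>

definition select_action ::
  "('s::polish_space, 'a::polish_space) mdp \<Rightarrow> ('s \<Rightarrow> 'a measure) \<Rightarrow> 's \<Rightarrow> ('s \<times> 'a) measure" where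
  "select_action M \<pi> s = distr (\<pi> s) (state_space M \<Otimes>\<^sub>M action_space M) (Pair s)"

primrec path_step ::
  "('s::polish_space, 'a::polish_space) mdp \<Rightarrow> ('s \<Rightarrow> 'a measure) \<Rightarrow> 's \<Rightarrow>
     nat \<Rightarrow> (nat \<Rightarrow> 's \<times> 'a) \<Rightarrow> ('s \<times> 'a) measure" where
  "path_step M \<pi> s 0 \<omega> = select_action M \<pi> s"
| "path_step M \<pi> s (Suc t) \<omega> = kernel M (\<omega> t) \<bind> select_action M \<pi>"

definition path_measure ::
  "('s::polish_space, 'a::polish_space) mdp \<Rightarrow> ('s \<Rightarrow> 'a measure) \<Rightarrow> 's \<Rightarrow> (nat \<Rightarrow> 's \<times> 'a) measure" where
  "path_measure M \<pi> s =
     projective_family.lim UNIV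
       (Ionescu_Tulcea.CI (path_step M \<pi> s) (\<lambda>_. state_space M \<Otimes>\<^sub>M action_space M))
       (\<lambda>_. state_space M \<Otimes>\<^sub>M action_space M)"

lemma measurable_select_action:
  assumes "\<pi> \<in> policies M"
  shows "select_action M \<pi> \<in> state_space M \<rightarrow>\<^sub>M prob_algebra (state_space M \<Otimes>\<^sub>M action_space M)"
proof -
  have [measurable]: "\<pi> \<in> state_space M \<rightarrow>\<^sub>M prob_algebra (action_space M)"
    using assms by (simp add: policies_def)
  show ?thesis
    unfolding select_action_def by measurable
qed

text \<open>The hypotheses of the Ionescu-Tulcea theorem hold, so \<open>path_measure\<close> is the intended law.\<close>

lemma Ionescu_Tulcea_path_step:
  assumes "is_mdp c_min M" and pi: "\<pi> \<in> policies M" and "s \<in> states M"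
  shows "Ionescu_Tulcea (path_step M \<pi> s) (\<lambda>_. state_space M \<Otimes>\<^sub>M action_space M)"
proof -
  let ?N = "state_space M \<Otimes>\<^sub>M action_space M"
  have [measurable]: "kernel M \<in> ?N \<rightarrow>\<^sub>M prob_algebra (state_space M)"
    using assms by (simp add: is_mdp_def)
  note [measurable] = measurable_select_action[OF pi]
  have s: "s \<in> space (state_space M)"
    using assms by (simp add: state_space_def space_restrict_space)
  have step: "path_step M \<pi> s t \<in> PiM {0..<t} (\<lambda>_. ?N) \<rightarrow>\<^sub>M prob_algebra ?N" for t
  proof (cases t)
    case 0
    have "select_action M \<pi> s \<in> space (prob_algebra ?N)"
      using measurable_space[OF measurable_select_action[OF pi] s] .
    moreover have "path_step M \<pi> s 0 = (\<lambda>_. select_action M \<pi> s)"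
      by (rule ext) simp
    ultimately show ?thesis
      using 0 by simp
  next
    case (Suc n)
    have [measurable]: "(\<lambda>\<omega>. \<omega> n) \<in> PiM {0..<Suc n} (\<lambda>_. ?N) \<rightarrow>\<^sub>M ?N"
      by (rule measurable_component_singleton) simp
    have "path_step M \<pi> s (Suc n) = (\<lambda>\<omega>. kernel M (\<omega> n) \<bind> select_action M \<pi>)"
      by (rule ext) simp
    moreover have "(\<lambda>\<omega>. kernel M (\<omega> n) \<bind> select_action M \<pi>)
        \<in> PiM {0..<Suc n} (\<lambda>_. ?N) \<rightarrow>\<^sub>M prob_algebra ?N"
      by measurable
    ultimately show ?thesis
      using Suc by simp
  qed
  show ?thesis
  proof (rule Ionescu_Tulcea.intro)
    show "path_step M \<pi> s t \<in> PiM {0..<t} (\<lambda>_. ?N) \<rightarrow>\<^sub>M subprob_algebra ?N" for t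
      by (rule measurable_prob_algebraD[OF step])
    show "prob_space (path_step M \<pi> s t \<omega>)" if "\<omega> \<in> space (PiM {0..<t} (\<lambda>_. ?N))" for t \<omega>
      using measurable_space[OF step that] by (simp add: space_prob_algebra)
  qed
qed

text \<open>
  The series converges in \<^typ>\<open>ereal\<close> along every path, because the costs are bounded below; its sum
  may be \<open>\<infinity>\<close>.
\<close>

definition value_fn ::
  "('s::polish_space, 'a::polish_space) mdp \<Rightarrow> ('s \<Rightarrow> 'a measure) \<Rightarrow> 's \<Rightarrow> ereal" where
  "value_fn M \<pi> s =
     ext_integral (path_measure M \<pi> s) (\<lambda>\<omega>. \<Sum>t. ereal (discount M ^ t * cost M (\<omega> t)))"

definition bellman ::
  "('s::polish_space, 'a::polish_space) mdp \<Rightarrow> ('s \<Rightarrow> 'a measure) \<Rightarrow> ('s \<Rightarrow> ereal) \<Rightarrow> 's \<Rightarrow> ereal" where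
  "bellman M \<pi> v s =
     policy_cost M \<pi> s + ereal (discount M) * ext_integral (policy_kernel M \<pi> s) v"

definition bellman_opt ::
  "('s::polish_space, 'a::polish_space) mdp \<Rightarrow> ('s \<Rightarrow> ereal) \<Rightarrow> 's \<Rightarrow> ereal" where
  "bellman_opt M v s =
     (INF a\<in>actions M. ereal (cost M (s, a)) + ereal (discount M) * ext_integral (kernel M (s, a)) v)"

definition greedy ::
  "('s::polish_space, 'a::polish_space) mdp \<Rightarrow> ('s \<Rightarrow> ereal) \<Rightarrow> ('s \<Rightarrow> 'a measure) set" where
  "greedy M v = {\<pi> \<in> policies M. \<forall>s\<in>states M. bellman M \<pi> v s = bellman_opt M v s}"

definition wnorm :: "'s set \<Rightarrow> ('s \<Rightarrow> real) \<Rightarrow> ('s \<Rightarrow> ereal) \<Rightarrow> ennreal" where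
  "wnorm S w v = (SUP s\<in>S. e2ennreal (\<bar>v s\<bar> / ereal (w s)))"

definition value_space ::
  "real \<Rightarrow> ('s::polish_space, 'a::polish_space) mdp \<Rightarrow> ('s \<Rightarrow> ereal) set" where
  "value_space c_min M =
     {v \<in> borel_measurable (state_space M). \<forall>s\<in>states M. ereal (c_min / (1 - discount M)) \<le> v s}"

definition weighted_value_space ::
  "real \<Rightarrow> ('s::polish_space, 'a::polish_space) mdp \<Rightarrow> ('s \<Rightarrow> real) \<Rightarrow> ('s \<Rightarrow> ereal) set" where
  "weighted_value_space c_min M w = {v \<in> value_space c_min M. wnorm (states M) w v < \<infinity>}"

definition is_opt_value ::
  "real \<Rightarrow> ('s::polish_space, 'a::polish_space) mdp \<Rightarrow> ('s \<Rightarrow> real) \<Rightarrow> ('s \<Rightarrow> ereal) \<Rightarrow> bool" where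
  "is_opt_value c_min M w V \<longleftrightarrow>
     V \<in> weighted_value_space c_min M w \<and>
     (\<forall>\<pi>\<in>policies M. \<forall>s\<in>states M. V s \<le> value_fn M \<pi> s) \<and>
     (\<exists>\<pi>\<in>policies M. \<forall>s\<in>states M. V s = value_fn M \<pi> s) \<and>
     (\<forall>s\<in>states M. V s = bellman_opt M V s)"

definition DP_solvable ::
  "real \<Rightarrow> ('s::polish_space, 'a::polish_space) mdp \<Rightarrow> ('s \<Rightarrow> real) \<Rightarrow> bool" where
  "DP_solvable c_min M w \<longleftrightarrow>
     (\<forall>v\<in>weighted_value_space c_min M w. bellman_opt M v \<in> weighted_value_space c_min M w) \<and>
     (\<exists>V. is_opt_value c_min M w V)"

text \<open>
  The weight is not required to be measurable; for a non-measurable \<open>w\<close> the integral below is the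
  lower integral.
\<close>

definition stable_policies ::
  "('s::polish_space, 'a::polish_space) mdp \<Rightarrow> real \<Rightarrow> ('s \<Rightarrow> real) \<Rightarrow> ('s \<Rightarrow> 'a measure) set" where
  "stable_policies M \<kappa> w =
     {\<pi> \<in> policies M. wnorm (states M) w (policy_cost M \<pi>) < \<infinity> \<and>
        (\<forall>s\<in>states M. (\<integral>\<^sup>+ s'. ennreal (w s') \<partial>policy_kernel M \<pi> s) \<le> ennreal (\<kappa> * w s))}"

definition open_loop :: "('s::polish_space, 'a::polish_space) mdp \<Rightarrow> 'a \<Rightarrow> 's \<Rightarrow> 'a measure" where
  "open_loop M a = (\<lambda>s. return (action_space M) a)"

definition affine_mdp ::
  "real \<Rightarrow> real \<Rightarrow> ('s, 'a) mdp \<Rightarrow> ('s, 'a) mdp" where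
  "affine_mdp \<alpha>1 \<alpha>2 M = M\<lparr>cost := \<lambda>x. \<alpha>1 * cost M x + \<alpha>2\<rparr>"

definition mismatch_max ::
  "('s::polish_space, 'a::polish_space) mdp \<Rightarrow> ('s, 'a) mdp \<Rightarrow> ('s \<Rightarrow> real) \<Rightarrow> real \<Rightarrow> real \<Rightarrow>
     ('s \<Rightarrow> ereal) \<Rightarrow> ennreal" where
  "mismatch_max M M' w \<alpha>1 \<alpha>2 v =
     (SUP a\<in>actions M. wnorm (states M) w
        (\<lambda>s. bellman (affine_mdp \<alpha>1 \<alpha>2 M) (open_loop M a) v s - bellman M' (open_loop M a) v s))"

end

theory Submission
  imports Defs
begin

text \<open>
  Write \<open>\<gamma>\<close> for the discount factor, \<open>V\<close> and \<open>V'\<close> for the two optimal value functions, \<open>D\<close> for the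
  mismatch and \<open>N\<close> for the affine transform of the first model. Transforming the costs moves value
  functions by \<open>x \<mapsto> \<alpha>\<^sub>1 x + \<alpha>\<^sub>2 / (1 - \<gamma>)\<close>; let \<open>U\<close> be the image of \<open>V\<close>, the optimal value of \<open>N\<close>.
  The mismatch says that the one-step action values of \<open>N\<close> and of the second model differ by at most
  \<open>D w\<close> at a given function.

  Two estimates carry the proof. First, open-loop stability makes both optimality operators
  \<open>\<gamma> \<kappa>\<close>-contractions in the weighted norm, and a uniform bound over actions survives the infimum, so
  \<open>\<bar>V' - U\<bar> \<le> D w / (1 - \<gamma> \<kappa>)\<close> whether the mismatch is measured at \<open>V'\<close> or at \<open>U\<close>
  (\<open>optimal_values_distance\<close>). Second, if a function solves the Bellman equation of a stable policy up
  to \<open>e w\<close>, then the value function of the policy is within \<open>e w / (1 - \<gamma> \<kappa>)\<close> of it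
  (\<open>value_fn_near_approximate_fixed_point\<close>). The optimal policy of the second model is greedy for \<open>V'\<close>,
  so \<open>V'\<close> is the average over this policy of the action values at \<open>V'\<close> in the second model, and the
  mismatch controls Bellman residuals in the first model.

  For the bound in terms of \<open>V'\<close>, the second estimate is applied at the preimage of \<open>V'\<close> under the
  affine map: the residual is \<open>D w / \<alpha>\<^sub>1\<close>, and the preimage differs from \<open>V\<close> by at most
  \<open>D w / (\<alpha>\<^sub>1 (1 - \<gamma> \<kappa>))\<close> by the first estimate; these two errors give the factor 2.
  For the bound in terms of \<open>V\<close>, it is applied at \<open>V\<close>: the residual is at most \<open>1 / \<alpha>\<^sub>1\<close> times
  \<open>D + \<gamma> \<kappa> \<delta> + \<delta>\<close> with \<open>\<delta> = D / (1 - \<gamma> \<kappa>)\<close>, and this sum equals \<open>2 \<delta>\<close>.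

  The value function is defined as an integral over infinite paths. The bridge to one-step operators
  is \<open>path_measure_marginal\<close>, which identifies the law of the state-action pair at each time of the
  Ionescu-Tulcea process with a step of the state chain. Under a stable policy, functions of order
  \<open>w\<close> have integrals of order \<open>\<kappa>\<^sup>t w(s)\<close> at time \<open>t\<close>, so all discounted series converge absolutely
  and the rest is real-valued.
\<close>

section \<open>Extended integrals, bind and the weighted norm\<close>

lemma ext_integral_eq_integral:
  fixes f :: "'x \<Rightarrow> real"
  assumes "integrable \<mu> f"
  shows "ext_integral \<mu> (\<lambda>x. ereal (f x)) = ereal (\<integral>x. f x \<partial>\<mu>)"
proof -
  have "(\<integral>\<^sup>+ x. ennreal (f x) \<partial>\<mu>) \<noteq> \<infinity>" "(\<integral>\<^sup>+ x. ennreal (- f x) \<partial>\<mu>) \<noteq> \<infinity>"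
    using assms by (auto simp: real_integrable_def)
  then obtain p n where p: "(\<integral>\<^sup>+ x. ennreal (f x) \<partial>\<mu>) = ennreal p" "0 \<le> p"
    and n: "(\<integral>\<^sup>+ x. ennreal (- f x) \<partial>\<mu>) = ennreal n" "0 \<le> n"
    by (metis ennreal_cases infinity_ennreal_def)
  have "ext_integral \<mu> (\<lambda>x. ereal (f x)) = ereal (p - n)"
    using p n by (simp add: ext_integral_def enn2ereal_ennreal)
  moreover have "(\<integral>x. f x \<partial>\<mu>) = p - n"
    using p n by (simp add: real_lebesgue_integral_def[OF assms])
  ultimately show ?thesis by simp
qed

lemma ext_integral_cong_AE:
  assumes "AE x in \<mu>. f x = g x"
  shows "ext_integral \<mu> f = ext_integral \<mu> g"
proof -
  have "(\<integral>\<^sup>+ x. e2ennreal (f x) \<partial>\<mu>) = (\<integral>\<^sup>+ x. e2ennreal (g x) \<partial>\<mu>)"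
    using assms by (intro nn_integral_cong_AE) auto
  moreover have "(\<integral>\<^sup>+ x. e2ennreal (- f x) \<partial>\<mu>) = (\<integral>\<^sup>+ x. e2ennreal (- g x) \<partial>\<mu>)"
    using assms by (intro nn_integral_cong_AE) auto
  ultimately show ?thesis
    by (simp add: ext_integral_def)
qed

text \<open>
  A function bounded below has a finite negative part under a probability measure, so only the
  positive part could make the extended integral infinite.
\<close>

lemma integrable_of_ext_integral_finite:
  fixes f :: "'x \<Rightarrow> real"
  assumes "prob_space \<mu>" and [measurable]: "f \<in> borel_measurable \<mu>"
    and lower: "\<And>x. x \<in> space \<mu> \<Longrightarrow> b \<le> f x"
    and finite: "ext_integral \<mu> (\<lambda>x. ereal (f x)) \<noteq> \<infinity>"
  shows "integrable \<mu> f"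
proof -
  interpret prob_space \<mu> by fact
  have "(\<integral>\<^sup>+ x. ennreal (- f x) \<partial>\<mu>) \<le> (\<integral>\<^sup>+ x. ennreal \<bar>b\<bar> \<partial>\<mu>)"
    using lower by (intro nn_integral_mono ennreal_leI) force
  also have "\<dots> = ennreal \<bar>b\<bar>"
    by (simp add: emeasure_space_1)
  finally have neg: "(\<integral>\<^sup>+ x. ennreal (- f x) \<partial>\<mu>) \<noteq> \<infinity>"
    using ennreal_less_top neq_top_trans by force
  then obtain n where n: "(\<integral>\<^sup>+ x. ennreal (- f x) \<partial>\<mu>) = ennreal n" "0 \<le> n"
    by (metis ennreal_cases infinity_ennreal_def)
  have "(\<integral>\<^sup>+ x. ennreal (f x) \<partial>\<mu>) \<noteq> \<infinity>"
    using finite n by (auto simp: ext_integral_def enn2ereal_ennreal)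
  with neg show ?thesis
    by (simp add: real_integrable_def)
qed

text \<open>
  Fubini for a kernel, for integrands that need not be bounded: it holds for the positive and the
  negative part by monotone convergence, and the finiteness assumption on the double integral of the
  absolute value allows these parts to be subtracted, pointwise and after integration.
\<close>

lemma
  fixes h :: "'y \<Rightarrow> real"
  assumes M: "prob_space M" and K: "K \<in> M \<rightarrow>\<^sub>M prob_algebra N"
    and h[measurable]: "h \<in> borel_measurable N"
    and inner: "\<And>x. x \<in> space M \<Longrightarrow> integrable (K x) h"
    and fin: "(\<integral>\<^sup>+ x. \<integral>\<^sup>+ y. ennreal \<bar>h y\<bar> \<partial>K x \<partial>M) < \<infinity>"
  shows integrable_inner_integral: "integrable M (\<lambda>x. \<integral>y. h y \<partial>K x)"
    and integral_bind_eq: "(\<integral>y. h y \<partial>(M \<bind> K)) = (\<integral>x. \<integral>y. h y \<partial>K x \<partial>M)"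
proof -
  have Ks[measurable]: "K \<in> M \<rightarrow>\<^sub>M subprob_algebra N"
    by (rule measurable_prob_algebraD[OF K])
  have sets: "sets (M \<bind> K) = sets N"
    by (rule sets_bind[OF subprob_measurableD(2)[OF Ks] prob_space.not_empty[OF M]])
  have hb[measurable]: "h \<in> borel_measurable (M \<bind> K)"
    using h by (simp cong: measurable_cong_sets add: sets)
  have int: "integrable (M \<bind> K) h"
    using fin by (intro integrableI_bounded hb) (simp add: nn_integral_bind[OF _ Ks])
  define p where "p = (\<lambda>x. \<integral>\<^sup>+ y. ennreal (h y) \<partial>K x)"
  define n where "n = (\<lambda>x. \<integral>\<^sup>+ y. ennreal (- h y) \<partial>K x)"
  have [measurable]: "p \<in> borel_measurable M" "n \<in> borel_measurable M"
    unfolding p_def n_def by measurable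
  have p_fin: "p x < \<infinity>" and n_fin: "n x < \<infinity>" if "x \<in> space M" for x
    using inner[OF that] by (auto simp: real_integrable_def p_def n_def less_top)
  have "(\<integral>\<^sup>+ x. p x \<partial>M) \<le> (\<integral>\<^sup>+ x. \<integral>\<^sup>+ y. ennreal \<bar>h y\<bar> \<partial>K x \<partial>M)"
    unfolding p_def by (intro nn_integral_mono ennreal_leI) auto
  then have ip: "(\<integral>\<^sup>+ x. p x \<partial>M) < \<infinity>"
    using fin by (rule le_less_trans)
  have "(\<integral>\<^sup>+ x. n x \<partial>M) \<le> (\<integral>\<^sup>+ x. \<integral>\<^sup>+ y. ennreal \<bar>h y\<bar> \<partial>K x \<partial>M)"
    unfolding n_def by (intro nn_integral_mono ennreal_leI) auto
  then have inn: "(\<integral>\<^sup>+ x. n x \<partial>M) < \<infinity>"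
    using fin by (rule le_less_trans)
  have p_eq: "(\<integral>\<^sup>+ x. ennreal (enn2real (p x)) \<partial>M) = (\<integral>\<^sup>+ x. p x \<partial>M)"
    using p_fin by (intro nn_integral_cong) auto
  have n_eq: "(\<integral>\<^sup>+ x. ennreal (enn2real (n x)) \<partial>M) = (\<integral>\<^sup>+ x. n x \<partial>M)"
    using n_fin by (intro nn_integral_cong) auto
  have ip': "integrable M (\<lambda>x. enn2real (p x))"
    using ip by (intro integrableI_nonneg) (auto simp: p_eq)
  have in': "integrable M (\<lambda>x. enn2real (n x))"
    using inn by (intro integrableI_nonneg) (auto simp: n_eq)
  have eq: "(\<integral>y. h y \<partial>K x) = enn2real (p x) - enn2real (n x)" if "x \<in> space M" for x
    using real_lebesgue_integral_def[OF inner[OF that]] by (simp add: p_def n_def)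
  show "integrable M (\<lambda>x. \<integral>y. h y \<partial>K x)"
    using Bochner_Integration.integrable_diff[OF ip' in']
    by (simp add: eq cong: Bochner_Integration.integrable_cong)
  have "(\<integral>x. \<integral>y. h y \<partial>K x \<partial>M) = (\<integral>x. enn2real (p x) \<partial>M) - (\<integral>x. enn2real (n x) \<partial>M)"
    using Bochner_Integration.integral_diff[OF ip' in']
    by (simp add: eq cong: Bochner_Integration.integral_cong)
  also have "\<dots> = enn2real (\<integral>\<^sup>+ x. p x \<partial>M) - enn2real (\<integral>\<^sup>+ x. n x \<partial>M)"
    by (simp add: integral_eq_nn_integral p_eq n_eq)
  also have "\<dots> = (\<integral>y. h y \<partial>(M \<bind> K))"
    by (simp add: real_lebesgue_integral_def[OF int] nn_integral_bind[OF _ Ks] p_def n_def)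
  finally show "(\<integral>y. h y \<partial>(M \<bind> K)) = (\<integral>x. \<integral>y. h y \<partial>K x \<partial>M)" ..
qed

lemma
  fixes f :: "'x \<Rightarrow> real"
  assumes f: "f \<in> borel_measurable \<mu>" and le: "(\<integral>\<^sup>+ x. ennreal \<bar>f x\<bar> \<partial>\<mu>) \<le> ennreal B" and "0 \<le> B"
  shows integrable_of_nn_integral_abs_le: "integrable \<mu> f"
    and abs_integral_le_of_nn_integral_abs_le: "\<bar>\<integral>x. f x \<partial>\<mu>\<bar> \<le> B"
    and integral_abs_le_of_nn_integral_abs_le: "(\<integral>x. \<bar>f x\<bar> \<partial>\<mu>) \<le> B"
proof -
  have "(\<integral>\<^sup>+ x. ennreal \<bar>f x\<bar> \<partial>\<mu>) < \<infinity>"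
    using le by (rule le_less_trans) simp
  with f show int: "integrable \<mu> f"
    by (intro integrableI_bounded) simp_all
  have "(\<integral>x. \<bar>f x\<bar> \<partial>\<mu>) = enn2real (\<integral>\<^sup>+ x. ennreal \<bar>f x\<bar> \<partial>\<mu>)"
    using f by (intro integral_eq_nn_integral) auto
  also have "\<dots> \<le> B"
    using le \<open>0 \<le> B\<close> by (rule enn2real_leI[rotated])
  finally show abs: "(\<integral>x. \<bar>f x\<bar> \<partial>\<mu>) \<le> B" .
  have "\<bar>\<integral>x. f x \<partial>\<mu>\<bar> \<le> (\<integral>x. \<bar>f x\<bar> \<partial>\<mu>)"
    by (rule integral_abs_bound)
  then show "\<bar>\<integral>x. f x \<partial>\<mu>\<bar> \<le> B"
    using abs by (rule order_trans)
qed

lemma wnorm_le_iff: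
  assumes w: "\<forall>s\<in>S. 0 < w s" and "0 \<le> C"
  shows "wnorm S w v \<le> ennreal C \<longleftrightarrow> (\<forall>s\<in>S. \<bar>v s\<bar> \<le> ereal (C * w s))"
proof -
  have "e2ennreal (\<bar>v s\<bar> / ereal (w s)) \<le> ennreal C \<longleftrightarrow> \<bar>v s\<bar> \<le> ereal (C * w s)" if "s \<in> S" for s
  proof -
    have "0 \<le> \<bar>v s\<bar> / ereal (w s)"
      using bspec[OF w that] by simp
    then have "e2ennreal (\<bar>v s\<bar> / ereal (w s)) \<le> ennreal C \<longleftrightarrow> \<bar>v s\<bar> / ereal (w s) \<le> ereal C"
      using \<open>0 \<le> C\<close> by (simp add: less_eq_ennreal.rep_eq enn2ereal_e2ennreal enn2ereal_ennreal)
    also have "\<dots> \<longleftrightarrow> \<bar>v s\<bar> \<le> ereal (w s) * ereal C"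
      using bspec[OF w that] by (intro ereal_divide_le_pos) auto
    finally show ?thesis
      by (simp add: mult.commute)
  qed
  then show ?thesis
    by (auto simp: wnorm_def SUP_le_iff)
qed

lemma wnorm_finiteE:
  assumes w: "\<forall>s\<in>S. 0 < w s" and "wnorm S w v < \<infinity>"
  obtains C where "0 \<le> C" "\<forall>s\<in>S. \<bar>v s\<bar> \<le> ereal (C * w s)"
proof -
  obtain C where C: "0 \<le> C" "wnorm S w v = ennreal C"
    using assms(2) by (metis ennreal_cases infinity_ennreal_def less_irrefl)
  with wnorm_le_iff[OF w C(1), where v = v] show ?thesis
    by (auto intro: that)
qed

section \<open>The state process of a policy\<close>

lemma space_state_space: "states M \<in> sets borel \<Longrightarrow> space (state_space M) = states M"
  by (simp add: state_space_def space_restrict_space)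

lemma space_action_space: "actions M \<in> sets borel \<Longrightarrow> space (action_space M) = actions M"
  by (simp add: action_space_def space_restrict_space)

primrec state_law ::
  "('s::polish_space, 'a::polish_space) mdp \<Rightarrow> ('s \<Rightarrow> 'a measure) \<Rightarrow> 's \<Rightarrow> nat \<Rightarrow> 's measure" where
  "state_law M \<pi> s 0 = return (state_space M) s"
| "state_law M \<pi> s (Suc t) = state_law M \<pi> s t \<bind> policy_kernel M \<pi>"

definition mean_cost ::
  "('s::polish_space, 'a::polish_space) mdp \<Rightarrow> ('s \<Rightarrow> 'a measure) \<Rightarrow> 's \<Rightarrow> real" where
  "mean_cost M \<pi> s = (\<integral>a. cost M (s, a) \<partial>\<pi> s)"

locale mdp_policy =
  fixes c_min :: real and M :: "('s::polish_space, 'a::polish_space) mdp" and \<pi> :: "'s \<Rightarrow> 'a measure"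
  assumes mdp: "is_mdp c_min M" and policy: "\<pi> \<in> policies M"
begin

lemma space_S[simp]: "space (state_space M) = states M"
  using mdp by (simp add: is_mdp_def space_state_space)

lemma space_A[simp]: "space (action_space M) = actions M"
  using mdp by (simp add: is_mdp_def space_action_space)

lemma kernel_measurable[measurable]:
  "kernel M \<in> state_space M \<Otimes>\<^sub>M action_space M \<rightarrow>\<^sub>M prob_algebra (state_space M)"
  using mdp by (simp add: is_mdp_def)

lemma cost_measurable[measurable]:
  "cost M \<in> borel_measurable (state_space M \<Otimes>\<^sub>M action_space M)"
  using mdp by (simp add: is_mdp_def)

lemma cost_lower: "s \<in> states M \<Longrightarrow> a \<in> actions M \<Longrightarrow> c_min \<le> cost M (s, a)"
  using mdp by (simp add: is_mdp_def)

lemma discount: "0 < discount M" "discount M < 1"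
  using mdp by (auto simp: is_mdp_def)

lemma policy_measurable[measurable]: "\<pi> \<in> state_space M \<rightarrow>\<^sub>M prob_algebra (action_space M)"
  using policy by (simp add: policies_def)

lemma policy_kernel_measurable[measurable]:
  "policy_kernel M \<pi> \<in> state_space M \<rightarrow>\<^sub>M prob_algebra (state_space M)"
  unfolding policy_kernel_def[abs_def] by measurable

lemma select_action_measurable[measurable]:
  "select_action M \<pi> \<in> state_space M \<rightarrow>\<^sub>M prob_algebra (state_space M \<Otimes>\<^sub>M action_space M)"
  by (rule measurable_select_action[OF policy])

lemma prob_space_policy: "s \<in> states M \<Longrightarrow> prob_space (\<pi> s)"
  and sets_policy: "s \<in> states M \<Longrightarrow> sets (\<pi> s) = sets (action_space M)"
  using measurable_space[OF policy_measurable, of s] by (auto simp: space_prob_algebra)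

lemma space_policy: "s \<in> states M \<Longrightarrow> space (\<pi> s) = actions M"
  using sets_eq_imp_space_eq[OF sets_policy, of s] by simp

lemma prob_space_policy_kernel: "s \<in> states M \<Longrightarrow> prob_space (policy_kernel M \<pi> s)"
  and sets_policy_kernel: "s \<in> states M \<Longrightarrow> sets (policy_kernel M \<pi> s) = sets (state_space M)"
  using measurable_space[OF policy_kernel_measurable, of s] by (auto simp: space_prob_algebra)

lemma space_policy_kernel: "s \<in> states M \<Longrightarrow> space (policy_kernel M \<pi> s) = states M"
  using sets_eq_imp_space_eq[OF sets_policy_kernel, of s] by simp

lemma kernel_section_measurable:
  "s \<in> states M \<Longrightarrow> (\<lambda>a. kernel M (s, a)) \<in> \<pi> s \<rightarrow>\<^sub>M prob_algebra (state_space M)"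
  by (subst measurable_cong_sets[OF sets_policy refl]) (auto intro!: measurable_compose[OF _ kernel_measurable] measurable_Pair)

lemma cost_section_measurable:
  "s \<in> states M \<Longrightarrow> (\<lambda>a. cost M (s, a)) \<in> borel_measurable (\<pi> s)"
  by (subst measurable_cong_sets[OF sets_policy refl]) (auto intro!: measurable_compose[OF _ cost_measurable] measurable_Pair)

lemma Pair_measurable: "s \<in> states M \<Longrightarrow> Pair s \<in> \<pi> s \<rightarrow>\<^sub>M state_space M \<Otimes>\<^sub>M action_space M"
  by (subst measurable_cong_sets[OF sets_policy refl]) auto

lemma mean_cost_measurable[measurable]: "mean_cost M \<pi> \<in> borel_measurable (state_space M)"
proof -
  have "(\<lambda>s. \<integral>x. cost M x \<partial>select_action M \<pi> s) \<in> borel_measurable (state_space M)"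
    by (rule measurable_compose[OF measurable_prob_algebraD[OF select_action_measurable]
          integral_measurable_subprob_algebra[OF cost_measurable]])
  then show ?thesis
    by (subst measurable_cong[where g = "\<lambda>s. \<integral>x. cost M x \<partial>select_action M \<pi> s"])
      (simp_all add: mean_cost_def select_action_def integral_distr[OF Pair_measurable])
qed

lemma state_law_in_prob_algebra:
  "s \<in> states M \<Longrightarrow> state_law M \<pi> s t \<in> space (prob_algebra (state_space M))"
proof (induction t)
  case 0
  then show ?case
    by (auto simp: space_prob_algebra intro!: prob_space_return)
next
  case (Suc t)
  then show ?case
    using prob_space_bind'[OF Suc.IH policy_kernel_measurable] sets_bind'[OF Suc.IH policy_kernel_measurable]
    by (simp add: space_prob_algebra)
qed

lemma prob_space_state_law: "s \<in> states M \<Longrightarrow> prob_space (state_law M \<pi> s t)"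
  and sets_state_law: "s \<in> states M \<Longrightarrow> sets (state_law M \<pi> s t) = sets (state_space M)"
  using state_law_in_prob_algebra[of s t] by (auto simp: space_prob_algebra)

lemma space_state_law: "s \<in> states M \<Longrightarrow> space (state_law M \<pi> s t) = states M"
  using sets_eq_imp_space_eq[OF sets_state_law, of s] by simp

lemma select_action_bind_kernel:
  assumes "s \<in> states M"
  shows "select_action M \<pi> s \<bind> kernel M = policy_kernel M \<pi> s"
  unfolding select_action_def policy_kernel_def
proof (rule bind_distr)
  show "Pair s \<in> \<pi> s \<rightarrow>\<^sub>M state_space M \<Otimes>\<^sub>M action_space M"
    by (rule Pair_measurable[OF assms])
  show "kernel M \<in> state_space M \<Otimes>\<^sub>M action_space M \<rightarrow>\<^sub>M subprob_algebra (state_space M)"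
    by (rule measurable_prob_algebraD[OF kernel_measurable])
  show "space (\<pi> s) \<noteq> {}"
    using prob_space.not_empty[OF prob_space_policy[OF assms]] .
qed

lemma sets_path_measure:
  assumes "s \<in> states M"
  shows "sets (path_measure M \<pi> s) = sets (PiM UNIV (\<lambda>_. state_space M \<Otimes>\<^sub>M action_space M))"
proof -
  interpret IT: Ionescu_Tulcea "path_step M \<pi> s" "\<lambda>_. state_space M \<Otimes>\<^sub>M action_space M"
    by (rule Ionescu_Tulcea_path_step[OF mdp policy assms])
  show ?thesis
    by (simp add: path_measure_def)
qed

text \<open>
  The coordinate at time \<open>t\<close> depends only on the first \<open>t + 1\<close> steps of the Ionescu-Tulcea
  construction, whose last step appends a draw from \<^const>\<open>path_step\<close>. Since that draw looks at
  the past only through the previous state-action pair, associativity of bind turns "draw an action,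
  then a next state" into one step of the state chain.
\<close>

lemma path_measure_marginal:
  assumes s: "s \<in> states M"
  shows "distr (path_measure M \<pi> s) (state_space M \<Otimes>\<^sub>M action_space M) (\<lambda>\<omega>. \<omega> t)
           = state_law M \<pi> s t \<bind> select_action M \<pi>"
proof -
  let ?N = "state_space M \<Otimes>\<^sub>M action_space M"
  interpret IT: Ionescu_Tulcea "path_step M \<pi> s" "\<lambda>_. ?N"
    by (rule Ionescu_Tulcea_path_step[OF mdp policy s])
  let ?C = "\<lambda>t. IT.C 0 t (\<lambda>_. undefined)"
  have u: "(\<lambda>_. undefined) \<in> space (PiM {0..<0::nat} (\<lambda>_. ?N))"
    by (auto simp: space_PiM)
  have sets_C: "sets (?C t) = sets (PiM {0..<t} (\<lambda>_. ?N))" for t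
    using IT.sets_C[OF u, of t] by simp
  have nonempty: "space (?C t) \<noteq> {}" for t
    using prob_space.not_empty[OF IT.prob_space_C[OF u, of t]] .
  have sel[measurable]: "select_action M \<pi> \<in> state_space M \<rightarrow>\<^sub>M subprob_algebra ?N"
    by (rule measurable_prob_algebraD[OF select_action_measurable])
  have ker[measurable]: "kernel M \<in> ?N \<rightarrow>\<^sub>M subprob_algebra (state_space M)"
    by (rule measurable_prob_algebraD[OF kernel_measurable])
  have pk[measurable]: "policy_kernel M \<pi> \<in> state_space M \<rightarrow>\<^sub>M subprob_algebra (state_space M)"
    by (rule measurable_prob_algebraD[OF policy_kernel_measurable])
  have comp: "(\<lambda>\<omega>. \<omega> t) \<in> PiM J (\<lambda>_. ?N) \<rightarrow>\<^sub>M ?N" if "t \<in> J" for t J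
    using that by (rule measurable_component_singleton)
  have last: "distr (?C (Suc t)) ?N (\<lambda>\<omega>. \<omega> t) = ?C t \<bind> path_step M \<pi> s t" for t
  proof -
    have eP: "IT.eP t \<in> ?C t \<rightarrow>\<^sub>M subprob_algebra (PiM {0..<Suc t} (\<lambda>_. ?N))"
      using IT.measurable_eP[of t] by (subst measurable_cong_sets[OF sets_C refl])
    have "distr (?C (Suc t)) ?N (\<lambda>\<omega>. \<omega> t) = ?C t \<bind> (\<lambda>\<omega>. distr (IT.eP t \<omega>) ?N (\<lambda>\<omega>. \<omega> t))"
      by (simp add: distr_bind[OF eP nonempty comp])
    also have "\<dots> = ?C t \<bind> path_step M \<pi> s t"
    proof (rule bind_cong)
      fix \<omega> assume "\<omega> \<in> space (?C t)"
      then have \<omega>: "\<omega> \<in> space (PiM {0..<t} (\<lambda>_. ?N))"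
        using sets_eq_imp_space_eq[OF sets_C] by simp
      have upd: "fun_upd \<omega> t \<in> path_step M \<pi> s t \<omega> \<rightarrow>\<^sub>M PiM {0..<Suc t} (\<lambda>_. ?N)"
        using \<omega> by (subst measurable_cong_sets[OF IT.sets_P[OF \<omega>] refl])
          (rule measurable_fun_upd[where J = "{0..<t}"], auto)
      have "distr (IT.eP t \<omega>) ?N (\<lambda>\<omega>. \<omega> t) = distr (path_step M \<pi> s t \<omega>) ?N ((\<lambda>\<omega>. \<omega> t) \<circ> fun_upd \<omega> t)"
        unfolding IT.eP_def by (rule distr_distr[OF comp upd]) simp
      also have "\<dots> = path_step M \<pi> s t \<omega>"
        by (simp add: comp_def distr_id2[OF IT.sets_P[OF \<omega>, symmetric]])
      finally show "distr (IT.eP t \<omega>) ?N (\<lambda>\<omega>. \<omega> t) = path_step M \<pi> s t \<omega>" .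
    qed simp
    finally show ?thesis .
  qed
  have law: "?C t \<bind> path_step M \<pi> s t = state_law M \<pi> s t \<bind> select_action M \<pi>" for t
  proof (induction t)
    case 0
    have "?C 0 \<bind> path_step M \<pi> s 0 = path_step M \<pi> s 0 (\<lambda>_. undefined)"
      unfolding IT.C.simps(1) by (rule bind_return[OF IT.P u])
    also have "\<dots> = state_law M \<pi> s 0 \<bind> select_action M \<pi>"
      using s by (simp add: bind_return[OF sel])
    finally show ?case .
  next
    case (Suc n)
    have meas: "(\<lambda>\<omega>. \<omega> n) \<in> ?C (Suc n) \<rightarrow>\<^sub>M ?N"
      by (subst measurable_cong_sets[OF sets_C refl]) (simp add: comp)
    have step[measurable]: "(\<lambda>x. kernel M x \<bind> select_action M \<pi>) \<in> ?N \<rightarrow>\<^sub>M subprob_algebra ?N"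
      by (rule measurable_prob_algebraD) measurable
    have sl: "sets (state_law M \<pi> s n) = sets (state_space M)"
      by (rule sets_state_law[OF s])
    have "?C (Suc n) \<bind> path_step M \<pi> s (Suc n)
        = ?C (Suc n) \<bind> (\<lambda>\<omega>. kernel M (\<omega> n) \<bind> select_action M \<pi>)"
      by (rule arg_cong[where f = "bind (?C (Suc n))"]) (rule ext, simp)
    also have "\<dots> = distr (?C (Suc n)) ?N (\<lambda>\<omega>. \<omega> n) \<bind> (\<lambda>x. kernel M x \<bind> select_action M \<pi>)"
      by (rule bind_distr[OF meas step nonempty, symmetric])
    also have "\<dots> = (state_law M \<pi> s n \<bind> select_action M \<pi>) \<bind> (\<lambda>x. kernel M x \<bind> select_action M \<pi>)"
      by (simp only: last Suc.IH)
    also have "\<dots> = state_law M \<pi> s n \<bind> (\<lambda>x. select_action M \<pi> x \<bind> (\<lambda>y. kernel M y \<bind> select_action M \<pi>))"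
      by (rule bind_assoc[OF _ step]) (simp add: measurable_cong_sets[OF sl refl] sel)
    also have "\<dots> = state_law M \<pi> s n \<bind> (\<lambda>x. policy_kernel M \<pi> x \<bind> select_action M \<pi>)"
    proof (rule bind_cong)
      fix x assume "x \<in> space (state_law M \<pi> s n)"
      then have x: "x \<in> states M"
        using sets_eq_imp_space_eq[OF sl] by simp
      have sx: "sets (select_action M \<pi> x) = sets ?N"
        using x by (intro subprob_measurableD(2)[OF sel]) simp
      have "select_action M \<pi> x \<bind> (\<lambda>y. kernel M y \<bind> select_action M \<pi>)
          = (select_action M \<pi> x \<bind> kernel M) \<bind> select_action M \<pi>"
        by (rule bind_assoc[OF _ sel, symmetric]) (simp add: measurable_cong_sets[OF sx refl] ker)
      then show "select_action M \<pi> x \<bind> (\<lambda>y. kernel M y \<bind> select_action M \<pi>)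
          = policy_kernel M \<pi> x \<bind> select_action M \<pi>"
        by (simp add: select_action_bind_kernel[OF x])
    qed simp
    also have "\<dots> = state_law M \<pi> s (Suc n) \<bind> select_action M \<pi>"
      by (simp add: bind_assoc[OF _ sel] measurable_cong_sets[OF sl refl] pk)
    finally show ?case .
  qed
  \<comment> \<open>The projective limit is read off on the finite set of coordinates below \<open>Suc t\<close>.\<close>
  have "IT.up_to {t} = Suc t"
    using IT.up_to_less[of "{t}" t] IT.up_to_iff[of "{t}" "Suc t"] by auto
  then have CI: "IT.CI {t} = distr (?C (Suc t)) (PiM {t} (\<lambda>_. ?N)) (\<lambda>f. restrict f {t})"
    by (simp add: IT.CI_def)
  have r1: "(\<lambda>f. restrict f {t}) \<in> IT.PF.lim \<rightarrow>\<^sub>M PiM {t} (\<lambda>_. ?N)"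
    by (subst measurable_cong_sets[OF IT.PF.sets_lim refl]) (auto intro!: measurable_restrict_subset)
  have r2: "(\<lambda>f. restrict f {t}) \<in> ?C (Suc t) \<rightarrow>\<^sub>M PiM {t} (\<lambda>_. ?N)"
    by (subst measurable_cong_sets[OF sets_C refl]) (auto intro!: measurable_restrict_subset)
  have "distr (path_measure M \<pi> s) ?N (\<lambda>\<omega>. \<omega> t)
      = distr IT.PF.lim ?N ((\<lambda>\<omega>. \<omega> t) \<circ> (\<lambda>f. restrict f {t}))"
    by (simp add: path_measure_def comp_def)
  also have "\<dots> = distr (IT.CI {t}) ?N (\<lambda>\<omega>. \<omega> t)"
    by (subst distr_distr[OF comp r1, symmetric]) (simp_all add: IT.distr_lim)
  also have "\<dots> = distr (?C (Suc t)) ?N (\<lambda>\<omega>. \<omega> t)"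
    unfolding CI by (subst distr_distr[OF comp r2]) (simp_all add: comp_def)
  finally show ?thesis
    by (simp only: last law)
qed


lemma integral_select_action:
  fixes f :: "'s \<times> 'a \<Rightarrow> real"
  assumes "f \<in> borel_measurable (state_space M \<Otimes>\<^sub>M action_space M)" "s \<in> states M"
  shows "(\<integral>x. f x \<partial>select_action M \<pi> s) = (\<integral>a. f (s, a) \<partial>\<pi> s)"
  using assms by (simp add: select_action_def integral_distr[OF Pair_measurable])

lemma nn_integral_select_action:
  assumes "f \<in> borel_measurable (state_space M \<Otimes>\<^sub>M action_space M)" "s \<in> states M"
  shows "(\<integral>\<^sup>+x. f x \<partial>select_action M \<pi> s) = (\<integral>\<^sup>+a. f (s, a) \<partial>\<pi> s)"
  using assms by (simp add: select_action_def nn_integral_distr[OF Pair_measurable])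

lemma coordinate_measurable:
  "s \<in> states M \<Longrightarrow> (\<lambda>\<omega>. \<omega> t) \<in> path_measure M \<pi> s \<rightarrow>\<^sub>M state_space M \<Otimes>\<^sub>M action_space M"
  by (subst measurable_cong_sets[OF sets_path_measure refl]) (auto intro: measurable_component_singleton)

lemma select_action_subprob_measurable:
  "s \<in> states M \<Longrightarrow>
    select_action M \<pi> \<in> state_law M \<pi> s t \<rightarrow>\<^sub>M subprob_algebra (state_space M \<Otimes>\<^sub>M action_space M)"
  by (subst measurable_cong_sets[OF sets_state_law refl])
    (auto intro: measurable_prob_algebraD[OF select_action_measurable])

lemma nn_integral_path_coordinate:
  assumes f: "f \<in> borel_measurable (state_space M \<Otimes>\<^sub>M action_space M)" and s: "s \<in> states M"
  shows "(\<integral>\<^sup>+\<omega>. f (\<omega> t) \<partial>path_measure M \<pi> s)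
           = (\<integral>\<^sup>+x. \<integral>\<^sup>+a. f (x, a) \<partial>\<pi> x \<partial>state_law M \<pi> s t)"
proof -
  have "(\<integral>\<^sup>+\<omega>. f (\<omega> t) \<partial>path_measure M \<pi> s)
      = (\<integral>\<^sup>+x. f x \<partial>(state_law M \<pi> s t \<bind> select_action M \<pi>))"
    using f by (simp add: path_measure_marginal[OF s, symmetric] nn_integral_distr[OF coordinate_measurable[OF s]])
  also have "\<dots> = (\<integral>\<^sup>+x. \<integral>\<^sup>+y. f y \<partial>select_action M \<pi> x \<partial>state_law M \<pi> s t)"
    by (rule nn_integral_bind[OF f select_action_subprob_measurable[OF s]])
  also have "\<dots> = (\<integral>\<^sup>+x. \<integral>\<^sup>+a. f (x, a) \<partial>\<pi> x \<partial>state_law M \<pi> s t)"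
    by (intro nn_integral_cong) (simp add: nn_integral_select_action[OF f] space_state_law[OF s])
  finally show ?thesis .
qed

end

section \<open>Geometric growth along a stable policy\<close>

locale stable_policy = mdp_policy c_min M \<pi>
  for c_min :: real and M :: "('s::polish_space, 'a::polish_space) mdp" and \<pi> :: "'s \<Rightarrow> 'a measure" +
  fixes \<kappa> :: real and w :: "'s \<Rightarrow> real"
  assumes weight: "\<forall>s\<in>states M. 1 \<le> w s"
    and \<kappa>_pos: "0 < \<kappa>" and contraction: "discount M * \<kappa> < 1"
    and stable: "\<pi> \<in> stable_policies M \<kappa> w"
begin

lemma weight_pos: "s \<in> states M \<Longrightarrow> 0 < w s"
  using weight by force

text \<open>
  The integral of \<open>w\<close> in the definition of stability is a lower integral, for which iterated integrals
  against kernels may fail to make sense. Bounds are therefore stated for measurable functions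
  dominated by a multiple of \<open>w\<close>; dividing by that multiple reduces this one to stability.
\<close>

lemma nn_integral_policy_kernel_le:
  assumes g: "g \<in> borel_measurable (state_space M)"
    and le: "\<forall>x\<in>states M. g x \<le> ennreal (C * w x)" and "0 \<le> C" and s: "s \<in> states M"
  shows "(\<integral>\<^sup>+ x. g x \<partial>policy_kernel M \<pi> s) \<le> ennreal (C * \<kappa> * w s)"
proof (cases "C = 0")
  case True
  then have "(\<integral>\<^sup>+ x. g x \<partial>policy_kernel M \<pi> s) = (\<integral>\<^sup>+ x. 0 \<partial>policy_kernel M \<pi> s)"
    using le s by (intro nn_integral_cong) (simp add: space_policy_kernel)
  then show ?thesis by simp
next
  case False
  with \<open>0 \<le> C\<close> have C: "0 < C" by simp
  have g': "g \<in> borel_measurable (policy_kernel M \<pi> s)"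
    using g by (simp cong: measurable_cong_sets add: sets_policy_kernel[OF s])
  have "(\<integral>\<^sup>+ x. g x \<partial>policy_kernel M \<pi> s)
      = (\<integral>\<^sup>+ x. ennreal C * (ennreal (1 / C) * g x) \<partial>policy_kernel M \<pi> s)"
    using C by (simp add: mult.assoc[symmetric] ennreal_mult[symmetric])
  also have "\<dots> = ennreal C * (\<integral>\<^sup>+ x. ennreal (1 / C) * g x \<partial>policy_kernel M \<pi> s)"
    using g' by (intro nn_integral_cmult) auto
  also have "\<dots> \<le> ennreal C * (\<integral>\<^sup>+ x. ennreal (w x) \<partial>policy_kernel M \<pi> s)"
  proof (intro mult_left_mono nn_integral_mono)
    fix x assume "x \<in> space (policy_kernel M \<pi> s)"
    then have x: "x \<in> states M"
      by (simp add: space_policy_kernel s)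
    have "ennreal (1 / C) * g x \<le> ennreal (1 / C) * ennreal (C * w x)"
      using le x by (intro mult_left_mono) auto
    also have "\<dots> = ennreal (w x)"
      using C weight_pos[OF x] by (simp add: ennreal_mult[symmetric])
    finally show "ennreal (1 / C) * g x \<le> ennreal (w x)" .
  qed simp
  also have "\<dots> \<le> ennreal C * ennreal (\<kappa> * w s)"
    using stable s by (intro mult_left_mono) (auto simp: stable_policies_def)
  also have "\<dots> = ennreal (C * \<kappa> * w s)"
    using C \<kappa>_pos weight_pos[OF s] by (simp add: ennreal_mult[symmetric] mult.assoc)
  finally show ?thesis .
qed

text \<open>
  Integrating a dominated function against the kernel gives a measurable function that is dominated
  again, with constant \<open>C * \<kappa>\<close>; hence the induction must generalise over the function and its
  constant.
\<close>

lemma nn_integral_state_law_le: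
  assumes "g \<in> borel_measurable (state_space M)"
    and "\<forall>x\<in>states M. g x \<le> ennreal (C * w x)" and "0 \<le> C" and s: "s \<in> states M"
  shows "(\<integral>\<^sup>+ x. g x \<partial>state_law M \<pi> s t) \<le> ennreal (C * \<kappa> ^ t * w s)"
  using assms(1-3)
proof (induction t arbitrary: g C)
  case 0
  then show ?case
    using s by (simp add: nn_integral_return)
next
  case (Suc t)
  have K: "policy_kernel M \<pi> \<in> state_space M \<rightarrow>\<^sub>M subprob_algebra (state_space M)"
    by (rule measurable_prob_algebraD[OF policy_kernel_measurable])
  then have K': "policy_kernel M \<pi> \<in> state_law M \<pi> s t \<rightarrow>\<^sub>M subprob_algebra (state_space M)"
    by (simp add: measurable_cong_sets[OF sets_state_law[OF s] refl])
  have "(\<integral>\<^sup>+ x. g x \<partial>state_law M \<pi> s (Suc t))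
      = (\<integral>\<^sup>+ x. \<integral>\<^sup>+ y. g y \<partial>policy_kernel M \<pi> x \<partial>state_law M \<pi> s t)"
    by (simp add: nn_integral_bind[OF Suc.prems(1) K'])
  also have "\<dots> \<le> ennreal (C * \<kappa> * \<kappa> ^ t * w s)"
  proof (rule Suc.IH)
    show "(\<lambda>x. \<integral>\<^sup>+ y. g y \<partial>policy_kernel M \<pi> x) \<in> borel_measurable (state_space M)"
      using measurable_compose[OF K nn_integral_measurable_subprob_algebra[OF Suc.prems(1)]] .
    show "\<forall>x\<in>states M. (\<integral>\<^sup>+ y. g y \<partial>policy_kernel M \<pi> x) \<le> ennreal (C * \<kappa> * w x)"
      using nn_integral_policy_kernel_le[OF Suc.prems] by blast
    show "0 \<le> C * \<kappa>"
      using Suc.prems(3) \<kappa>_pos by simp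
  qed
  finally show ?case
    by (simp add: ac_simps)
qed

lemma
  fixes v :: "'s \<Rightarrow> real"
  assumes v: "v \<in> borel_measurable (state_space M)"
    and le: "\<forall>x\<in>states M. \<bar>v x\<bar> \<le> C * w x" and C: "0 \<le> C" and s: "s \<in> states M"
  shows integrable_policy_kernel: "integrable (policy_kernel M \<pi> s) v"
    and abs_integral_policy_kernel_le: "\<bar>\<integral>x. v x \<partial>policy_kernel M \<pi> s\<bar> \<le> C * \<kappa> * w s"
    and integrable_state_law: "integrable (state_law M \<pi> s t) v"
    and abs_integral_state_law_le: "\<bar>\<integral>x. v x \<partial>state_law M \<pi> s t\<bar> \<le> C * \<kappa> ^ t * w s"
    and integral_state_law_Suc: "(\<integral>x. v x \<partial>state_law M \<pi> s (Suc t))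
          = (\<integral>x. \<integral>y. v y \<partial>policy_kernel M \<pi> x \<partial>state_law M \<pi> s t)"
proof -
  have abs: "(\<lambda>x. ennreal \<bar>v x\<bar>) \<in> borel_measurable (state_space M)"
    using v by simp
  have le': "\<forall>x\<in>states M. ennreal \<bar>v x\<bar> \<le> ennreal (C * w x)"
    using le by (auto intro: ennreal_leI)
  have nonneg: "0 \<le> C * \<kappa> * w x" "0 \<le> C * \<kappa> ^ t * w x" if "x \<in> states M" for x t
    using C \<kappa>_pos weight_pos[OF that] by simp_all
  have v_kernel: "v \<in> borel_measurable (policy_kernel M \<pi> x)" if "x \<in> states M" for x
    using v by (simp cong: measurable_cong_sets add: sets_policy_kernel[OF that])
  have v_law: "v \<in> borel_measurable (state_law M \<pi> s t)" for t
    using v by (simp cong: measurable_cong_sets add: sets_state_law[OF s])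
  note kernel_le = nn_integral_policy_kernel_le[OF abs le' C]
  note law_le = nn_integral_state_law_le[OF abs le' C s]
  have kernel_int: "integrable (policy_kernel M \<pi> x) v" if "x \<in> states M" for x
    by (rule integrable_of_nn_integral_abs_le[OF v_kernel[OF that] kernel_le[OF that] nonneg(1)[OF that]])
  then show "integrable (policy_kernel M \<pi> s) v"
    using s .
  show "\<bar>\<integral>x. v x \<partial>policy_kernel M \<pi> s\<bar> \<le> C * \<kappa> * w s"
    by (rule abs_integral_le_of_nn_integral_abs_le[OF v_kernel[OF s] kernel_le[OF s] nonneg(1)[OF s]])
  show "integrable (state_law M \<pi> s t) v"
    by (rule integrable_of_nn_integral_abs_le[OF v_law law_le nonneg(2)[OF s]])
  show "\<bar>\<integral>x. v x \<partial>state_law M \<pi> s t\<bar> \<le> C * \<kappa> ^ t * w s"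
    by (rule abs_integral_le_of_nn_integral_abs_le[OF v_law law_le nonneg(2)[OF s]])
  have K: "policy_kernel M \<pi> \<in> state_law M \<pi> s t \<rightarrow>\<^sub>M prob_algebra (state_space M)"
    by (simp add: measurable_cong_sets[OF sets_state_law[OF s] refl])
  have "(\<integral>\<^sup>+ x. \<integral>\<^sup>+ y. ennreal \<bar>v y\<bar> \<partial>policy_kernel M \<pi> x \<partial>state_law M \<pi> s t)
      = (\<integral>\<^sup>+ x. ennreal \<bar>v x\<bar> \<partial>state_law M \<pi> s (Suc t))"
    by (simp add: nn_integral_bind[OF abs measurable_prob_algebraD[OF K]])
  also have "\<dots> < \<infinity>"
    using law_le by (rule le_less_trans) simp
  finally show "(\<integral>x. v x \<partial>state_law M \<pi> s (Suc t))
          = (\<integral>x. \<integral>y. v y \<partial>policy_kernel M \<pi> x \<partial>state_law M \<pi> s t)"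
    using integral_bind_eq[OF prob_space_state_law[OF s] K v] kernel_int
    by (simp add: space_state_law[OF s])
qed

lemma policy_kernel_integral_measurable:
  fixes v :: "'s \<Rightarrow> real"
  assumes "v \<in> borel_measurable (state_space M)"
  shows "(\<lambda>s. \<integral>x. v x \<partial>policy_kernel M \<pi> s) \<in> borel_measurable (state_space M)"
  by (rule measurable_compose[OF measurable_prob_algebraD[OF policy_kernel_measurable]
        integral_measurable_subprob_algebra[OF assms]])

lemma policy_cost_boundE:
  obtains C where "0 \<le> C" "\<forall>s\<in>states M. \<bar>policy_cost M \<pi> s\<bar> \<le> ereal (C * w s)"
  by (rule wnorm_finiteE[of "states M" w "policy_cost M \<pi>"])
    (use stable weight_pos in \<open>auto simp: stable_policies_def\<close>)

lemma integrable_cost: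
  assumes s: "s \<in> states M"
  shows "integrable (\<pi> s) (\<lambda>a. cost M (s, a))"
proof (rule integrable_of_ext_integral_finite)
  obtain C where "\<forall>s\<in>states M. \<bar>policy_cost M \<pi> s\<bar> \<le> ereal (C * w s)"
    by (rule policy_cost_boundE)
  with s show "ext_integral (\<pi> s) (\<lambda>a. ereal (cost M (s, a))) \<noteq> \<infinity>"
    by (auto simp: policy_cost_def)
  show "prob_space (\<pi> s)" "(\<lambda>a. cost M (s, a)) \<in> borel_measurable (\<pi> s)"
    using s by (rule prob_space_policy, rule cost_section_measurable)
  show "c_min \<le> cost M (s, a)" if "a \<in> space (\<pi> s)" for a
    using that s by (simp add: space_policy cost_lower)
qed

lemma policy_cost_eq: "s \<in> states M \<Longrightarrow> policy_cost M \<pi> s = ereal (mean_cost M \<pi> s)"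
  by (simp add: policy_cost_def mean_cost_def ext_integral_eq_integral[OF integrable_cost])

text \<open>
  Stability bounds only the absolute value of the expected cost. Costs are bounded below, so
  \<open>\<bar>c\<bar> \<le> c + 2 \<bar>c_min\<bar>\<close>, and \<open>w \<ge> 1\<close> dominates the constant: the expected absolute cost is of
  order \<open>w\<close> too.
\<close>

lemma abs_cost_boundE:
  obtains C where "0 \<le> C"
    "\<forall>s\<in>states M. (\<integral>\<^sup>+ a. ennreal \<bar>cost M (s, a)\<bar> \<partial>\<pi> s) \<le> ennreal (C * w s)"
    "\<forall>s\<in>states M. \<bar>mean_cost M \<pi> s\<bar> \<le> C * w s"
proof -
  obtain C where C: "0 \<le> C" "\<forall>s\<in>states M. \<bar>policy_cost M \<pi> s\<bar> \<le> ereal (C * w s)"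
    by (rule policy_cost_boundE)
  let ?D = "C + 2 * \<bar>c_min\<bar>"
  have D: "0 \<le> ?D"
    using C(1) by simp
  have nn: "(\<integral>\<^sup>+ a. ennreal \<bar>cost M (s, a)\<bar> \<partial>\<pi> s) \<le> ennreal (?D * w s)" if s: "s \<in> states M" for s
  proof -
    interpret prob_space "\<pi> s"
      by (rule prob_space_policy[OF s])
    have shifted: "integrable (\<pi> s) (\<lambda>a. cost M (s, a) + 2 * \<bar>c_min\<bar>)"
      using integrable_cost[OF s] by simp
    have le: "\<bar>cost M (s, a)\<bar> \<le> cost M (s, a) + 2 * \<bar>c_min\<bar>" if "a \<in> space (\<pi> s)" for a
      using cost_lower[OF s, of a] that by (auto simp: space_policy[OF s])
    have "(\<integral>\<^sup>+ a. ennreal \<bar>cost M (s, a)\<bar> \<partial>\<pi> s) \<le> (\<integral>\<^sup>+ a. ennreal (cost M (s, a) + 2 * \<bar>c_min\<bar>) \<partial>\<pi> s)"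
      using le by (intro nn_integral_mono ennreal_leI) auto
    also have "\<dots> = ennreal (\<integral>a. cost M (s, a) + 2 * \<bar>c_min\<bar> \<partial>\<pi> s)"
      by (rule nn_integral_eq_integral[OF shifted]) (use le in force)
    also have "(\<integral>a. cost M (s, a) + 2 * \<bar>c_min\<bar> \<partial>\<pi> s) = mean_cost M \<pi> s + 2 * \<bar>c_min\<bar>"
      using integrable_cost[OF s] by (simp add: mean_cost_def prob_space)
    also have "\<dots> \<le> ?D * w s"
    proof -
      have "mean_cost M \<pi> s \<le> C * w s"
        using C(2) s by (force simp: policy_cost_eq)
      moreover have "2 * \<bar>c_min\<bar> * 1 \<le> 2 * \<bar>c_min\<bar> * w s"
        using weight s by (intro mult_left_mono) auto
      ultimately show ?thesis
        by (simp add: algebra_simps)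
    qed
    finally show ?thesis
      by (simp add: ennreal_leI)
  qed
  have "\<bar>mean_cost M \<pi> s\<bar> \<le> ?D * w s" if "s \<in> states M" for s
    unfolding mean_cost_def
    by (rule abs_integral_le_of_nn_integral_abs_le[OF cost_section_measurable nn])
      (use that D weight_pos[OF that] in auto)
  with nn D show ?thesis
    by (intro that) auto
qed

text \<open>
  The expected absolute discounted cost at time \<open>t\<close> is of order \<open>(\<gamma> \<kappa>)\<^sup>t w(s)\<close>, which is summable.
  This makes the random series converge absolutely almost surely and lets the expectation be taken
  term by term, each term being given by the law of the state at that time.
\<close>

lemma value_fn_sums:
  assumes s: "s \<in> states M"
  obtains r where "value_fn M \<pi> s = ereal r"
    "(\<lambda>t. discount M ^ t * (\<integral>x. mean_cost M \<pi> x \<partial>state_law M \<pi> s t)) sums r"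
proof -
  let ?P = "path_measure M \<pi> s" and ?N = "state_space M \<Otimes>\<^sub>M action_space M"
  let ?\<gamma> = "discount M"
  define X where "X = (\<lambda>t \<omega>. ?\<gamma> ^ t * cost M (\<omega> t :: 's \<times> 'a))"
  obtain C where C: "0 \<le> C"
    "\<forall>s\<in>states M. (\<integral>\<^sup>+ a. ennreal \<bar>cost M (s, a)\<bar> \<partial>\<pi> s) \<le> ennreal (C * w s)"
    "\<forall>s\<in>states M. \<bar>mean_cost M \<pi> s\<bar> \<le> C * w s"
    by (rule abs_cost_boundE)
  have coord[measurable]: "(\<lambda>\<omega>. \<omega> t) \<in> ?P \<rightarrow>\<^sub>M ?N" for t
    by (rule coordinate_measurable[OF s])
  have cost_meas[measurable]: "(\<lambda>\<omega>. cost M (\<omega> t)) \<in> borel_measurable ?P" for t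
    by (rule measurable_compose[OF coord cost_measurable])
  have X_meas: "X t \<in> borel_measurable ?P" for t
    unfolding X_def by measurable
  have sel_meas: "(\<lambda>x. \<integral>\<^sup>+ a. ennreal \<bar>cost M (x, a)\<bar> \<partial>\<pi> x) \<in> borel_measurable (state_space M)"
  proof -
    have "(\<lambda>x. \<integral>\<^sup>+ y. ennreal \<bar>cost M y\<bar> \<partial>select_action M \<pi> x) \<in> borel_measurable (state_space M)"
      by (rule measurable_compose[OF measurable_prob_algebraD[OF select_action_measurable]
            nn_integral_measurable_subprob_algebra]) measurable
    then show ?thesis
      by (rule measurable_cong[THEN iffD1, rotated]) (simp add: nn_integral_select_action)
  qed
  have abs_cost: "(\<integral>\<^sup>+ \<omega>. ennreal \<bar>cost M (\<omega> t)\<bar> \<partial>?P) \<le> ennreal (C * \<kappa> ^ t * w s)" for t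
    using nn_integral_path_coordinate[of "\<lambda>x. ennreal \<bar>cost M x\<bar>" s t] s
      nn_integral_state_law_le[OF sel_meas C(2,1) s, of t] by simp
  let ?b = "\<lambda>t. (?\<gamma> * \<kappa>) ^ t * (C * w s)"
  have b: "0 \<le> ?b t" for t
    using C(1) \<kappa>_pos weight_pos[OF s] discount by simp
  have abs_X: "(\<integral>\<^sup>+ \<omega>. ennreal \<bar>X t \<omega>\<bar> \<partial>?P) \<le> ennreal (?b t)" for t
  proof -
    have "(\<integral>\<^sup>+ \<omega>. ennreal \<bar>X t \<omega>\<bar> \<partial>?P) = ennreal (?\<gamma> ^ t) * (\<integral>\<^sup>+ \<omega>. ennreal \<bar>cost M (\<omega> t)\<bar> \<partial>?P)"
      using discount by (simp add: X_def abs_mult ennreal_mult nn_integral_cmult)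
    also have "\<dots> \<le> ennreal (?\<gamma> ^ t) * ennreal (C * \<kappa> ^ t * w s)"
      by (intro mult_left_mono abs_cost) simp
    also have "\<dots> = ennreal (?b t)"
      using discount C(1) \<kappa>_pos weight_pos[OF s] by (simp add: ennreal_mult[symmetric] power_mult_distrib ac_simps)
    finally show ?thesis .
  qed
  have b_sums: "summable ?b"
    using discount \<kappa>_pos contraction by (intro summable_mult2 summable_geometric) simp
  have X_int: "integrable ?P (X t)" for t
    by (rule integrable_of_nn_integral_abs_le[OF X_meas abs_X b])
  have "(\<integral>\<^sup>+ \<omega>. (\<Sum>t. ennreal \<bar>X t \<omega>\<bar>) \<partial>?P) = (\<Sum>t. \<integral>\<^sup>+ \<omega>. ennreal \<bar>X t \<omega>\<bar> \<partial>?P)"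
    using X_meas by (intro nn_integral_suminf) simp
  also have "\<dots> \<le> (\<Sum>t. ennreal (?b t))"
    by (intro suminf_le abs_X) auto
  also have "\<dots> = ennreal (\<Sum>t. ?b t)"
    by (rule suminf_ennreal2[OF b b_sums])
  finally have "(\<integral>\<^sup>+ \<omega>. (\<Sum>t. ennreal \<bar>X t \<omega>\<bar>) \<partial>?P) \<noteq> \<infinity>"
    by (auto simp: top_unique)
  then have "AE \<omega> in ?P. (\<Sum>t. ennreal \<bar>X t \<omega>\<bar>) \<noteq> \<infinity>"
    using X_meas by (intro nn_integral_PInf_AE) auto
  then have AE_sum: "AE \<omega> in ?P. summable (\<lambda>t. norm (X t \<omega>))"
    by eventually_elim (auto intro!: summable_suminf_not_top)
  have norm_sum: "summable (\<lambda>t. \<integral>\<omega>. norm (X t \<omega>) \<partial>?P)"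
    using integral_abs_le_of_nn_integral_abs_le[OF X_meas abs_X b]
    by (intro summable_comparison_test'[OF b_sums, of 0]) auto
  note series = integrable_suminf[OF X_int AE_sum norm_sum] sums_integral[OF X_int AE_sum norm_sum]
  have "value_fn M \<pi> s = ext_integral ?P (\<lambda>\<omega>. \<Sum>t. ereal (X t \<omega>))"
    by (simp add: value_fn_def X_def)
  also have "\<dots> = ext_integral ?P (\<lambda>\<omega>. ereal (\<Sum>t. X t \<omega>))"
  proof (rule ext_integral_cong_AE, use AE_sum in eventually_elim)
    case (elim \<omega>)
    then have "summable (\<lambda>t. X t \<omega>)"
      by (rule summable_norm_cancel)
    then show ?case
      by (intro sums_unique[symmetric]) (simp add: sums_ereal summable_sums)
  qed
  also have "\<dots> = ereal (\<integral>\<omega>. (\<Sum>t. X t \<omega>) \<partial>?P)"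
    by (rule ext_integral_eq_integral[OF series(1)])
  finally have val: "value_fn M \<pi> s = ereal (\<integral>\<omega>. (\<Sum>t. X t \<omega>) \<partial>?P)" .
  have "(\<integral>\<omega>. X t \<omega> \<partial>?P) = ?\<gamma> ^ t * (\<integral>x. mean_cost M \<pi> x \<partial>state_law M \<pi> s t)" for t
  proof -
    have "(\<integral>\<omega>. cost M (\<omega> t) \<partial>?P) = (\<integral>x. cost M x \<partial>(state_law M \<pi> s t \<bind> select_action M \<pi>))"
      by (simp add: path_measure_marginal[OF s, symmetric] integral_distr[OF coord])
    also have "\<dots> = (\<integral>x. \<integral>y. cost M y \<partial>select_action M \<pi> x \<partial>state_law M \<pi> s t)"
    proof (rule integral_bind_eq[OF prob_space_state_law[OF s] _ cost_measurable])
      show "select_action M \<pi> \<in> state_law M \<pi> s t \<rightarrow>\<^sub>M prob_algebra ?N"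
        by (simp add: measurable_cong_sets[OF sets_state_law[OF s] refl])
      show "integrable (select_action M \<pi> x) (cost M)" if "x \<in> space (state_law M \<pi> s t)" for x
        using that integrable_cost[of x] integrable_distr_eq[OF Pair_measurable cost_measurable, of x]
        by (simp add: select_action_def space_state_law[OF s])
      have "(\<integral>\<^sup>+ x. \<integral>\<^sup>+ y. ennreal \<bar>cost M y\<bar> \<partial>select_action M \<pi> x \<partial>state_law M \<pi> s t)
          = (\<integral>\<^sup>+ x. \<integral>\<^sup>+ a. ennreal \<bar>cost M (x, a)\<bar> \<partial>\<pi> x \<partial>state_law M \<pi> s t)"
        by (intro nn_integral_cong) (simp add: nn_integral_select_action space_state_law[OF s])
      also have "\<dots> < \<infinity>"
        using nn_integral_state_law_le[OF sel_meas C(2,1) s, of t] by (rule le_less_trans) simp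
      finally show "(\<integral>\<^sup>+ x. \<integral>\<^sup>+ y. ennreal \<bar>cost M y\<bar> \<partial>select_action M \<pi> x \<partial>state_law M \<pi> s t) < \<infinity>" .
    qed
    also have "\<dots> = (\<integral>x. mean_cost M \<pi> x \<partial>state_law M \<pi> s t)"
      by (intro Bochner_Integration.integral_cong)
        (simp_all add: integral_select_action mean_cost_def space_state_law[OF s])
    finally show ?thesis
      by (simp add: X_def)
  qed
  with series(2) show ?thesis
    by (intro that[OF val]) simp
qed

text \<open>
  With \<open>g\<close> the residual of \<open>v\<close> in the policy's Bellman equation and \<open>\<nu>\<^sub>t\<close> the law of the state at
  time \<open>t\<close>, the discounted integrals of \<open>g\<close> telescope to
  \<open>V\<^sup>\<pi>(s) - v(s) = \<Sum>\<^sub>t \<gamma>\<^sup>t \<integral> g d\<nu>\<^sub>t\<close>, because \<open>\<gamma>\<^sup>t \<integral> v d\<nu>\<^sub>t\<close> tends to \<open>0\<close>. Each term is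
  at most \<open>(\<gamma> \<kappa>)\<^sup>t e w(s)\<close>, and the geometric series gives the bound.
\<close>

lemma value_fn_near_approximate_fixed_point:
  fixes v :: "'s \<Rightarrow> real"
  assumes v: "v \<in> borel_measurable (state_space M)"
    and v_le: "\<forall>x\<in>states M. \<bar>v x\<bar> \<le> C * w x" and C: "0 \<le> C"
    and residual: "\<forall>x\<in>states M.
      \<bar>mean_cost M \<pi> x + discount M * (\<integral>y. v y \<partial>policy_kernel M \<pi> x) - v x\<bar> \<le> e * w x" and e: "0 \<le> e"
    and s: "s \<in> states M"
  shows "\<bar>value_fn M \<pi> s - ereal (v s)\<bar> \<le> ereal (e / (1 - discount M * \<kappa>) * w s)"
proof -
  let ?\<gamma> = "discount M" and ?\<nu> = "state_law M \<pi> s"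
  define g where "g = (\<lambda>x. mean_cost M \<pi> x + ?\<gamma> * (\<integral>y. v y \<partial>policy_kernel M \<pi> x) - v x)"
  have Kv[measurable]: "(\<lambda>x. \<integral>y. v y \<partial>policy_kernel M \<pi> x) \<in> borel_measurable (state_space M)"
    by (rule policy_kernel_integral_measurable[OF v])
  have Kv_le: "\<forall>x\<in>states M. \<bar>\<integral>y. v y \<partial>policy_kernel M \<pi> x\<bar> \<le> C * \<kappa> * w x"
    using abs_integral_policy_kernel_le[OF v v_le C] by blast
  have C\<kappa>: "0 \<le> C * \<kappa>"
    using C \<kappa>_pos by simp
  obtain B where B: "0 \<le> B" "\<forall>x\<in>states M. \<bar>mean_cost M \<pi> x\<bar> \<le> B * w x"
    by (rule abs_cost_boundE)
  have g[measurable]: "g \<in> borel_measurable (state_space M)"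
    unfolding g_def using v by measurable
  have g_le: "\<forall>x\<in>states M. \<bar>g x\<bar> \<le> e * w x"
    using residual by (simp add: g_def)
  obtain r where r: "value_fn M \<pi> s = ereal r"
    "(\<lambda>t. ?\<gamma> ^ t * (\<integral>x. mean_cost M \<pi> x \<partial>?\<nu> t)) sums r"
    by (rule value_fn_sums[OF s])
  \<comment> \<open>The terms whose differences telescope.\<close>
  define d where "d = (\<lambda>t. ?\<gamma> ^ t * (\<integral>x. v x \<partial>?\<nu> t))"
  have residual_law: "?\<gamma> ^ t * (\<integral>x. g x \<partial>?\<nu> t)
      = ?\<gamma> ^ t * (\<integral>x. mean_cost M \<pi> x \<partial>?\<nu> t) + (d (Suc t) - d t)" for t
  proof -
    note ints = integrable_state_law[OF mean_cost_measurable B(2,1) s, of t]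
      integrable_state_law[OF Kv Kv_le C\<kappa> s, of t] integrable_state_law[OF v v_le C s, of t]
    have g_int: "(\<integral>x. g x \<partial>?\<nu> t) = (\<integral>x. mean_cost M \<pi> x \<partial>?\<nu> t)
        + ?\<gamma> * (\<integral>x. \<integral>y. v y \<partial>policy_kernel M \<pi> x \<partial>?\<nu> t) - (\<integral>x. v x \<partial>?\<nu> t)"
      unfolding g_def using ints by simp
    show ?thesis
      unfolding d_def integral_state_law_Suc[OF v v_le C s] g_int by (simp add: algebra_simps)
  qed
  have rate: "0 \<le> ?\<gamma> * \<kappa>" "?\<gamma> * \<kappa> < 1"
    using discount \<kappa>_pos contraction by auto
  have "d \<longlonglongrightarrow> 0"
  proof (rule Lim_null_comparison)
    show "\<forall>\<^sub>F t in sequentially. norm (d t) \<le> (?\<gamma> * \<kappa>) ^ t * (C * w s)"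
    proof (rule always_eventually, rule allI)
      fix t
      have "norm (d t) = ?\<gamma> ^ t * \<bar>\<integral>x. v x \<partial>?\<nu> t\<bar>"
        using discount by (simp add: d_def abs_mult)
      also have "\<dots> \<le> ?\<gamma> ^ t * (C * \<kappa> ^ t * w s)"
        using discount by (intro mult_left_mono abs_integral_state_law_le[OF v v_le C s]) auto
      finally show "norm (d t) \<le> (?\<gamma> * \<kappa>) ^ t * (C * w s)"
        by (simp add: power_mult_distrib ac_simps)
    qed
    show "(\<lambda>t. (?\<gamma> * \<kappa>) ^ t * (C * w s)) \<longlonglongrightarrow> 0"
      using rate by (intro tendsto_mult_left_zero LIMSEQ_power_zero) simp
  qed
  from telescope_sums[OF this] have "(\<lambda>t. d (Suc t) - d t) sums (- v s)"
    using s v by (simp add: d_def integral_return)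
  from sums_add[OF r(2) this]
  have sums: "(\<lambda>t. ?\<gamma> ^ t * (\<integral>x. g x \<partial>?\<nu> t)) sums (r - v s)"
    by (simp add: residual_law)
  have term_le: "norm (?\<gamma> ^ t * (\<integral>x. g x \<partial>?\<nu> t)) \<le> (?\<gamma> * \<kappa>) ^ t * (e * w s)" for t
  proof -
    have "norm (?\<gamma> ^ t * (\<integral>x. g x \<partial>?\<nu> t)) = ?\<gamma> ^ t * \<bar>\<integral>x. g x \<partial>?\<nu> t\<bar>"
      using discount by (simp add: abs_mult)
    also have "\<dots> \<le> ?\<gamma> ^ t * (e * \<kappa> ^ t * w s)"
      using discount by (intro mult_left_mono abs_integral_state_law_le[OF g g_le e s]) auto
    finally show ?thesis
      by (simp add: power_mult_distrib ac_simps)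
  qed
  have geo: "(\<lambda>t. (?\<gamma> * \<kappa>) ^ t * (e * w s)) sums (1 / (1 - ?\<gamma> * \<kappa>) * (e * w s))"
    using rate by (intro sums_mult2 geometric_sums) simp
  have "\<bar>r - v s\<bar> \<le> e / (1 - ?\<gamma> * \<kappa>) * w s"
    using norm_suminf_le[OF term_le sums_summable[OF geo]] sums_unique[OF sums] sums_unique[OF geo]
    by simp
  then show ?thesis
    by (simp add: r(1))
qed

end

section \<open>Bellman operators on real-valued functions\<close>

definition action_value ::
  "('s::polish_space, 'a::polish_space) mdp \<Rightarrow> ('s \<Rightarrow> real) \<Rightarrow> 's \<Rightarrow> 'a \<Rightarrow> real" where
  "action_value M v s a = cost M (s, a) + discount M * (\<integral>x. v x \<partial>kernel M (s, a))"

text \<open>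
  The real-valued functions of finite weighted norm, with no lower bound imposed: affine images of
  optimal value functions may fall below \<open>c_min / (1 - \<gamma>)\<close>.
\<close>

definition weighted_fn ::
  "('s::polish_space, 'a::polish_space) mdp \<Rightarrow> ('s \<Rightarrow> real) \<Rightarrow> ('s \<Rightarrow> real) \<Rightarrow> bool" where
  "weighted_fn M w v \<longleftrightarrow>
     v \<in> borel_measurable (state_space M) \<and> (\<exists>C\<ge>0. \<forall>s\<in>states M. \<bar>v s\<bar> \<le> C * w s)"

text \<open>
  The equation \<open>v = \<B>\<^sup>\<star> v\<close> with its infimum spelled out as the greatest lower bound among the
  real numbers, so that comparisons of two such equations stay within real arithmetic.
\<close>

definition optimality_equation ::
  "('s::polish_space, 'a::polish_space) mdp \<Rightarrow> ('s \<Rightarrow> real) \<Rightarrow> bool" where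
  "optimality_equation M v \<longleftrightarrow>
     (\<forall>s\<in>states M. (\<forall>a\<in>actions M. v s \<le> action_value M v s a) \<and>
        (\<forall>y. (\<forall>a\<in>actions M. y \<le> action_value M v s a) \<longrightarrow> y \<le> v s))"

lemma weighted_fn_affine:
  assumes "weighted_fn M w v" and w: "\<forall>s\<in>states M. 1 \<le> w s"
  shows "weighted_fn M w (\<lambda>s. \<alpha> * v s + \<beta>)"
proof -
  obtain C where C: "0 \<le> C" "\<forall>s\<in>states M. \<bar>v s\<bar> \<le> C * w s"
    using assms by (auto simp: weighted_fn_def)
  have "\<bar>\<alpha> * v s + \<beta>\<bar> \<le> (\<bar>\<alpha>\<bar> * C + \<bar>\<beta>\<bar>) * w s" if "s \<in> states M" for s
  proof -
    have "\<bar>\<alpha> * v s + \<beta>\<bar> \<le> \<bar>\<alpha>\<bar> * \<bar>v s\<bar> + \<bar>\<beta>\<bar> * 1"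
      by (simp add: abs_mult[symmetric])
    also have "\<dots> \<le> \<bar>\<alpha>\<bar> * (C * w s) + \<bar>\<beta>\<bar> * w s"
      using C w that by (intro add_mono mult_left_mono) auto
    finally show ?thesis
      by (simp add: algebra_simps)
  qed
  moreover have "(\<lambda>s. \<alpha> * v s + \<beta>) \<in> borel_measurable (state_space M)"
    using assms by (auto simp: weighted_fn_def)
  moreover have "0 \<le> \<bar>\<alpha>\<bar> * C + \<bar>\<beta>\<bar>"
    using C by simp
  ultimately show ?thesis
    unfolding weighted_fn_def by blast
qed

lemma opt_valueE:
  assumes "is_opt_value c_min M w V" and w: "\<forall>s\<in>states M. 1 \<le> w s"
  obtains v where "weighted_fn M w v" "\<forall>s\<in>states M. V s = ereal (v s)"
    "\<forall>s\<in>states M. V s = bellman_opt M V s"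
proof -
  have V: "V \<in> borel_measurable (state_space M)" "wnorm (states M) w V < \<infinity>"
    and opt: "\<forall>s\<in>states M. V s = bellman_opt M V s"
    using assms by (auto simp: is_opt_value_def weighted_value_space_def value_space_def)
  obtain C where C: "0 \<le> C" "\<forall>s\<in>states M. \<bar>V s\<bar> \<le> ereal (C * w s)"
    by (rule wnorm_finiteE[OF _ V(2)]) (use w in force)
  let ?v = "\<lambda>s. real_of_ereal (V s)"
  have eq: "\<forall>s\<in>states M. V s = ereal (?v s)"
  proof
    fix s assume "s \<in> states M"
    with C show "V s = ereal (?v s)"
      by (cases "V s") force+
  qed
  have "\<bar>?v s\<bar> \<le> C * w s" if s: "s \<in> states M" for s
    using bspec[OF C(2) s] by (subst (asm) bspec[OF eq s]) simp
  with C(1) V(1) have "weighted_fn M w ?v"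
    unfolding weighted_fn_def by auto
  then show ?thesis
    using eq opt by (rule that)
qed

lemma (in stable_policy) bellman_eq:
  assumes "weighted_fn M w v" and V: "\<forall>x\<in>states M. V x = ereal (v x)" and s: "s \<in> states M"
  shows "bellman M \<pi> V s
    = ereal (mean_cost M \<pi> s + discount M * (\<integral>x. v x \<partial>policy_kernel M \<pi> s))"
proof -
  obtain C where C: "v \<in> borel_measurable (state_space M)" "\<forall>s\<in>states M. \<bar>v s\<bar> \<le> C * w s" "0 \<le> C"
    using assms by (auto simp: weighted_fn_def)
  have "ext_integral (policy_kernel M \<pi> s) V = ext_integral (policy_kernel M \<pi> s) (\<lambda>x. ereal (v x))"
    using V by (intro ext_integral_cong_AE AE_I2) (simp add: space_policy_kernel[OF s])
  also have "\<dots> = ereal (\<integral>x. v x \<partial>policy_kernel M \<pi> s)"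
    by (rule ext_integral_eq_integral[OF integrable_policy_kernel[OF C s]])
  finally show ?thesis
    by (simp add: bellman_def policy_cost_eq[OF s])
qed

text \<open>
  Stability of all open-loop policies bounds every kernel \<open>P(\<cdot> | s, a)\<close> in the weighted sense, which is
  what makes the optimality operator, an infimum over all actions, a contraction.
\<close>

locale stable_mdp =
  fixes c_min :: real and M :: "('s::polish_space, 'a::polish_space) mdp"
    and \<kappa> :: real and w :: "'s \<Rightarrow> real"
  assumes mdp: "is_mdp c_min M"
    and weight: "\<forall>s\<in>states M. 1 \<le> w s"
    and \<kappa>_pos: "0 < \<kappa>" and contraction: "discount M * \<kappa> < 1"
    and open_loop_stable: "\<forall>a\<in>actions M. open_loop M a \<in> stable_policies M \<kappa> w"
begin

lemma stable_policyI: "\<pi> \<in> stable_policies M \<kappa> w \<Longrightarrow> stable_policy c_min M \<pi> \<kappa> w"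
  using mdp weight \<kappa>_pos contraction
  by unfold_locales (auto simp: stable_policies_def)

lemma stable_policy_open_loop: "a \<in> actions M \<Longrightarrow> stable_policy c_min M (open_loop M a) \<kappa> w"
  using open_loop_stable by (intro stable_policyI) auto

lemma weight_pos: "s \<in> states M \<Longrightarrow> 0 < w s"
  using weight by force

lemma policy_kernel_open_loop:
  assumes s: "s \<in> states M" and a: "a \<in> actions M"
  shows "policy_kernel M (open_loop M a) s = kernel M (s, a)"
proof -
  interpret stable_policy c_min M "open_loop M a" \<kappa> w
    by (rule stable_policy_open_loop[OF a])
  show ?thesis
    unfolding policy_kernel_def open_loop_def
    using measurable_prob_algebraD[OF kernel_section_measurable[OF s]] a
    by (intro bind_return) (simp_all add: open_loop_def)
qed

lemma mean_cost_open_loop: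
  assumes s: "s \<in> states M" and a: "a \<in> actions M"
  shows "mean_cost M (open_loop M a) s = cost M (s, a)"
proof -
  interpret stable_policy c_min M "open_loop M a" \<kappa> w
    by (rule stable_policy_open_loop[OF a])
  show ?thesis
    using cost_section_measurable[OF s] a
    by (simp add: mean_cost_def open_loop_def integral_return)
qed

lemma bellman_open_loop:
  assumes "weighted_fn M w v" "\<forall>x\<in>states M. V x = ereal (v x)"
    and s: "s \<in> states M" and a: "a \<in> actions M"
  shows "bellman M (open_loop M a) V s = ereal (action_value M v s a)"
  using stable_policy.bellman_eq[OF stable_policy_open_loop[OF a] assms(1,2) s]
  by (simp add: action_value_def mean_cost_open_loop[OF s a] policy_kernel_open_loop[OF s a])

lemma integrable_kernel:
  assumes "weighted_fn M w v" and s: "s \<in> states M" and a: "a \<in> actions M"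
  shows "integrable (kernel M (s, a)) v"
proof -
  interpret stable_policy c_min M "open_loop M a" \<kappa> w
    by (rule stable_policy_open_loop[OF a])
  obtain C where "v \<in> borel_measurable (state_space M)" "\<forall>s\<in>states M. \<bar>v s\<bar> \<le> C * w s" "0 \<le> C"
    using assms(1) unfolding weighted_fn_def by blast
  from integrable_policy_kernel[OF this s] show ?thesis
    by (simp add: policy_kernel_open_loop[OF s a])
qed

lemma space_kernel:
  assumes s: "s \<in> states M" and a: "a \<in> actions M"
  shows "space (kernel M (s, a)) = states M"
proof -
  interpret stable_policy c_min M "open_loop M a" \<kappa> w
    by (rule stable_policy_open_loop[OF a])
  show ?thesis
    using space_policy_kernel[OF s] by (simp add: policy_kernel_open_loop[OF s a])
qed

lemma prob_space_kernel:
  assumes s: "s \<in> states M" and a: "a \<in> actions M"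
  shows "prob_space (kernel M (s, a))"
proof -
  interpret stable_policy c_min M "open_loop M a" \<kappa> w
    by (rule stable_policy_open_loop[OF a])
  show ?thesis
    using prob_space_policy_kernel[OF s] by (simp add: policy_kernel_open_loop[OF s a])
qed

lemma bellman_opt_imp_optimality_equation:
  assumes v: "weighted_fn M w v" and V: "\<forall>x\<in>states M. V x = ereal (v x)"
    and opt: "\<forall>s\<in>states M. V s = bellman_opt M V s"
  shows "optimality_equation M v"
  unfolding optimality_equation_def
proof (intro ballI)
  fix s assume s: "s \<in> states M"
  have "ext_integral (kernel M (s, a)) V = ereal (\<integral>x. v x \<partial>kernel M (s, a))" if a: "a \<in> actions M" for a
  proof -
    have "ext_integral (kernel M (s, a)) V = ext_integral (kernel M (s, a)) (\<lambda>x. ereal (v x))"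
      using V by (intro ext_integral_cong_AE AE_I2) (simp add: space_kernel[OF s a])
    then show ?thesis
      by (simp add: ext_integral_eq_integral[OF integrable_kernel[OF v s a]])
  qed
  then have "bellman_opt M V s = (INF a\<in>actions M. ereal (action_value M v s a))"
    unfolding bellman_opt_def by (intro INF_cong) (simp_all add: action_value_def)
  then have inf: "ereal (v s) = (INF a\<in>actions M. ereal (action_value M v s a))"
    using V opt s by simp
  show "(\<forall>a\<in>actions M. v s \<le> action_value M v s a) \<and>
        (\<forall>y. (\<forall>a\<in>actions M. y \<le> action_value M v s a) \<longrightarrow> y \<le> v s)"
  proof (intro conjI ballI allI impI)
    fix a assume "a \<in> actions M"
    then have "ereal (v s) \<le> ereal (action_value M v s a)"
      unfolding inf by (rule INF_lower)
    then show "v s \<le> action_value M v s a"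
      by simp
  next
    fix y assume "\<forall>a\<in>actions M. y \<le> action_value M v s a"
    then have "ereal y \<le> ereal (v s)"
      unfolding inf by (intro INF_greatest) simp
    then show "y \<le> v s"
      by simp
  qed
qed

lemma action_value_lipschitz:
  assumes u: "weighted_fn M w u" and v: "weighted_fn M w v"
    and C: "\<forall>x\<in>states M. \<bar>u x - v x\<bar> \<le> C * w x" "0 \<le> C"
    and s: "s \<in> states M" and a: "a \<in> actions M"
  shows "\<bar>action_value M u s a - action_value M v s a\<bar> \<le> discount M * \<kappa> * C * w s"
proof -
  have meas: "(\<lambda>x. u x - v x) \<in> borel_measurable (state_space M)"
    using u v by (auto simp: weighted_fn_def)
  have "\<bar>\<integral>x. u x - v x \<partial>kernel M (s, a)\<bar> \<le> C * \<kappa> * w s"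
    using stable_policy.abs_integral_policy_kernel_le[OF stable_policy_open_loop[OF a] meas C s]
    by (simp add: policy_kernel_open_loop[OF s a])
  then have "discount M * \<bar>\<integral>x. u x - v x \<partial>kernel M (s, a)\<bar> \<le> discount M * (C * \<kappa> * w s)"
    using mdp by (intro mult_left_mono) (auto simp: is_mdp_def)
  moreover have "action_value M u s a - action_value M v s a
      = discount M * (\<integral>x. u x - v x \<partial>kernel M (s, a))"
    by (simp add: action_value_def integrable_kernel[OF u s a] integrable_kernel[OF v s a] algebra_simps)
  moreover have "0 < discount M"
    using mdp by (auto simp: is_mdp_def)
  ultimately show ?thesis
    by (simp add: abs_mult ac_simps)
qed

lemma
  assumes v: "weighted_fn M w v" and \<pi>: "\<pi> \<in> stable_policies M \<kappa> w" and s: "s \<in> states M"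
  shows integrable_action_value: "integrable (\<pi> s) (\<lambda>a. action_value M v s a)"
    and integral_action_value: "(\<integral>a. action_value M v s a \<partial>\<pi> s)
      = mean_cost M \<pi> s + discount M * (\<integral>x. v x \<partial>policy_kernel M \<pi> s)"
proof -
  interpret stable_policy c_min M \<pi> \<kappa> w
    by (rule stable_policyI[OF \<pi>])
  have meas: "v \<in> borel_measurable (state_space M)"
    using v by (simp add: weighted_fn_def)
  obtain C where C: "\<forall>s\<in>states M. \<bar>v s\<bar> \<le> C * w s" "0 \<le> C"
    using v unfolding weighted_fn_def by blast
  have abs: "integrable (policy_kernel M \<pi> s) (\<lambda>x. \<bar>v x\<bar>)"
    using integrable_policy_kernel[OF meas C s] by simp
  have inner: "integrable (kernel M (s, a)) v" if "a \<in> space (\<pi> s)" for a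
    using that by (intro integrable_kernel[OF v s]) (simp add: space_policy[OF s])
  have abs_meas: "(\<lambda>x. ennreal \<bar>v x\<bar>) \<in> borel_measurable (state_space M)"
    using meas by simp
  have "(\<integral>\<^sup>+ a. \<integral>\<^sup>+ x. ennreal \<bar>v x\<bar> \<partial>kernel M (s, a) \<partial>\<pi> s)
      = (\<integral>\<^sup>+ x. ennreal \<bar>v x\<bar> \<partial>policy_kernel M \<pi> s)"
    unfolding policy_kernel_def
    by (rule nn_integral_bind[OF abs_meas measurable_prob_algebraD[OF kernel_section_measurable[OF s]], symmetric])
  also have "\<dots> < \<infinity>"
    using abs by (simp add: integrable_iff_bounded)
  finally have fin: "(\<integral>\<^sup>+ a. \<integral>\<^sup>+ x. ennreal \<bar>v x\<bar> \<partial>kernel M (s, a) \<partial>\<pi> s) < \<infinity>" .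
  note bind = prob_space_policy[OF s] kernel_section_measurable[OF s] meas inner fin
  have int: "integrable (\<pi> s) (\<lambda>a. \<integral>x. v x \<partial>kernel M (s, a))"
    by (rule integrable_inner_integral[OF bind])
  then show "integrable (\<pi> s) (\<lambda>a. action_value M v s a)"
    unfolding action_value_def by (intro Bochner_Integration.integrable_add integrable_cost[OF s]) simp
  show "(\<integral>a. action_value M v s a \<partial>\<pi> s)
      = mean_cost M \<pi> s + discount M * (\<integral>x. v x \<partial>policy_kernel M \<pi> s)"
    using int integrable_cost[OF s] integral_bind_eq[OF bind]
    by (simp add: action_value_def mean_cost_def policy_kernel_def)
qed

end

section \<open>Distance of optimal value functions\<close>

text \<open>
  The fixed-point inequality \<open>x \<le> D + \<rho> x\<close> for the weighted norm \<open>x\<close> of \<open>f\<close>, in terms of bounds for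
  that norm: iterating the step turns the initial bound into \<open>D / (1 - \<rho>) + \<rho>\<^sup>n C\<close>.
\<close>

lemma weighted_contraction_bound:
  fixes f :: "'s \<Rightarrow> real"
  assumes w: "\<forall>s\<in>S. 0 < w s"
    and init: "\<forall>s\<in>S. \<bar>f s\<bar> \<le> C * w s" "0 \<le> C"
    and step: "\<And>C. 0 \<le> C \<Longrightarrow> \<forall>s\<in>S. \<bar>f s\<bar> \<le> C * w s \<Longrightarrow> \<forall>s\<in>S. \<bar>f s\<bar> \<le> (D + \<rho> * C) * w s"
    and D: "0 \<le> D" and \<rho>: "0 \<le> \<rho>" "\<rho> < 1"
  shows "\<forall>s\<in>S. \<bar>f s\<bar> \<le> D / (1 - \<rho>) * w s"
proof
  fix s assume s: "s \<in> S"
  have iterate: "\<forall>s\<in>S. \<bar>f s\<bar> \<le> (D / (1 - \<rho>) + \<rho> ^ n * C) * w s" for n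
  proof (induction n)
    case 0
    have "C * w s \<le> (D / (1 - \<rho>) + \<rho> ^ 0 * C) * w s" if "s \<in> S" for s
      using w D \<rho> that by (intro mult_right_mono) (auto simp: less_imp_le)
    then show ?case
      using init(1) by (meson order_trans)
  next
    case (Suc n)
    have "D + \<rho> * (D / (1 - \<rho>) + \<rho> ^ n * C) = D / (1 - \<rho>) + \<rho> ^ Suc n * C"
      using \<rho> by (simp add: field_simps)
    moreover have "0 \<le> D / (1 - \<rho>) + \<rho> ^ n * C"
      using D \<rho> init by simp
    ultimately show ?case
      using step[OF _ Suc.IH] by simp
  qed
  have "(\<lambda>n. (D / (1 - \<rho>) + \<rho> ^ n * C) * w s) \<longlonglongrightarrow> (D / (1 - \<rho>) + 0 * C) * w s"
    using \<rho> by (intro tendsto_intros LIMSEQ_power_zero) simp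
  then show "\<bar>f s\<bar> \<le> D / (1 - \<rho>) * w s"
    using iterate s by (intro LIMSEQ_le_const) auto
qed

text \<open>
  For each action, passing from \<open>u\<close> in \<open>N\<close> to \<open>v\<close> in \<open>N'\<close> changes the action value by at most
  \<open>\<gamma> \<kappa> C w\<close> (replacing \<open>u\<close> by \<open>v\<close> within \<open>N\<close>, when \<open>\<bar>u - v\<bar> \<le> C w\<close>) plus the mismatch \<open>D w\<close>.
  Infima over actions of functions this close are equally close, so \<open>C\<close> may be replaced by
  \<open>D + \<gamma> \<kappa> C\<close>. The mismatch is measured at the fixed point of \<open>N'\<close>; exchanging the models
  measures it at the other one.
\<close>

lemma optimal_values_distance:
  assumes N: "stable_mdp c N \<kappa> w" and N': "stable_mdp c' N' \<kappa> w"
    and same: "states N' = states N" "actions N' = actions N" "discount N' = discount N"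
    and u: "weighted_fn N w u" "optimality_equation N u"
    and v: "weighted_fn N w v" "optimality_equation N' v"
    and mismatch: "\<forall>s\<in>states N. \<forall>a\<in>actions N. \<bar>action_value N v s a - action_value N' v s a\<bar> \<le> D * w s"
    and D: "0 \<le> D"
  shows "\<forall>s\<in>states N. \<bar>u s - v s\<bar> \<le> D / (1 - discount N * \<kappa>) * w s"
proof -
  interpret stable_mdp c N \<kappa> w by fact
  obtain A where A: "0 \<le> A" "\<forall>s\<in>states N. \<bar>u s\<bar> \<le> A * w s"
    using u(1) unfolding weighted_fn_def by blast
  obtain B where B: "0 \<le> B" "\<forall>s\<in>states N. \<bar>v s\<bar> \<le> B * w s"
    using v(1) unfolding weighted_fn_def by blast
  show ?thesis
  proof (rule weighted_contraction_bound)
    show "\<forall>s\<in>states N. 0 < w s"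
      using weight_pos by blast
    show "\<forall>s\<in>states N. \<bar>u s - v s\<bar> \<le> (A + B) * w s"
    proof
      fix s assume "s \<in> states N"
      with A(2) B(2) have "\<bar>u s\<bar> \<le> A * w s" "\<bar>v s\<bar> \<le> B * w s"
        by blast+
      then show "\<bar>u s - v s\<bar> \<le> (A + B) * w s"
        unfolding distrib_right by linarith
    qed
    show "0 \<le> A + B"
      using A B by simp
    show "0 \<le> discount N * \<kappa>"
      using mdp \<kappa>_pos by (auto simp: is_mdp_def)
    show "\<forall>s\<in>states N. \<bar>u s - v s\<bar> \<le> (D + discount N * \<kappa> * C) * w s"
      if C: "0 \<le> C" "\<forall>s\<in>states N. \<bar>u s - v s\<bar> \<le> C * w s" for C
    proof
      fix s assume s: "s \<in> states N"
      let ?e = "(D + discount N * \<kappa> * C) * w s"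
      have near: "\<bar>action_value N u s a - action_value N' v s a\<bar> \<le> ?e" if a: "a \<in> actions N" for a
        using action_value_lipschitz[OF u(1) v(1) C(2,1) s a] bspec[OF bspec[OF mismatch s] a]
        unfolding distrib_right by linarith
      have "u s - ?e \<le> action_value N' v s a" if a: "a \<in> actions N" for a
      proof -
        have "u s \<le> action_value N u s a"
          using u(2) s a by (simp add: optimality_equation_def)
        with near[OF a] show ?thesis by linarith
      qed
      then have 1: "u s - ?e \<le> v s"
        using v(2) s by (auto simp: optimality_equation_def same)
      have "v s - ?e \<le> action_value N u s a" if a: "a \<in> actions N" for a
      proof -
        have "v s \<le> action_value N' v s a"
          using v(2) s a by (simp add: optimality_equation_def same)
        with near[OF a] show ?thesis by linarith
      qed
      then have 2: "v s - ?e \<le> u s"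
        using u(2) s by (auto simp: optimality_equation_def)
      from 1 2 show "\<bar>u s - v s\<bar> \<le> ?e"
        by linarith
    qed
  qed (use D contraction in auto)
qed

section \<open>Affine transformation of the costs\<close>

lemma affine_mdp_simps[simp]:
  "states (affine_mdp \<alpha> \<beta> M) = states M" "actions (affine_mdp \<alpha> \<beta> M) = actions M"
  "kernel (affine_mdp \<alpha> \<beta> M) = kernel M" "discount (affine_mdp \<alpha> \<beta> M) = discount M"
  "cost (affine_mdp \<alpha> \<beta> M) = (\<lambda>x. \<alpha> * cost M x + \<beta>)"
  by (simp_all add: affine_mdp_def)

lemma affine_mdp_cong[simp]:
  fixes M :: "('s::polish_space, 'a::polish_space) mdp"
  shows "state_space (affine_mdp \<alpha> \<beta> M) = state_space M" "action_space (affine_mdp \<alpha> \<beta> M) = action_space M"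
    "policies (affine_mdp \<alpha> \<beta> M) = policies M" "open_loop (affine_mdp \<alpha> \<beta> M) = open_loop M"
    "policy_kernel (affine_mdp \<alpha> \<beta> M) = policy_kernel M"
    "weighted_fn (affine_mdp \<alpha> \<beta> M) w = weighted_fn M w"
  by (simp_all add: state_space_def action_space_def policies_def open_loop_def policy_kernel_def[abs_def]
      weighted_fn_def[abs_def] fun_eq_iff)

context stable_mdp
begin

lemma discount_pos: "0 < discount M" and discount_less_1: "discount M < 1"
  using mdp by (auto simp: is_mdp_def)

lemma stable_mdp_affine:
  assumes "0 < \<alpha>"
  shows "stable_mdp (\<alpha> * c_min + \<beta>) (affine_mdp \<alpha> \<beta> M) \<kappa> w"
proof
  show "is_mdp (\<alpha> * c_min + \<beta>) (affine_mdp \<alpha> \<beta> M)"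
    using mdp assms by (auto simp: is_mdp_def)
  show "\<forall>s\<in>states (affine_mdp \<alpha> \<beta> M). 1 \<le> w s" "0 < \<kappa>" "discount (affine_mdp \<alpha> \<beta> M) * \<kappa> < 1"
    using weight \<kappa>_pos contraction by simp_all
  show "\<forall>a\<in>actions (affine_mdp \<alpha> \<beta> M).
      open_loop (affine_mdp \<alpha> \<beta> M) a \<in> stable_policies (affine_mdp \<alpha> \<beta> M) \<kappa> w"
  proof
    fix a assume "a \<in> actions (affine_mdp \<alpha> \<beta> M)"
    then have a: "a \<in> actions M" by simp
    interpret stable_policy c_min M "open_loop M a" \<kappa> w
      by (rule stable_policy_open_loop[OF a])
    obtain C where C: "0 \<le> C" "\<forall>s\<in>states M. \<bar>mean_cost M (open_loop M a) s\<bar> \<le> C * w s"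
      by (rule abs_cost_boundE)
    have eq: "policy_cost (affine_mdp \<alpha> \<beta> M) (open_loop M a) s
        = ereal (\<alpha> * mean_cost M (open_loop M a) s + \<beta>)" if s: "s \<in> states M" for s
    proof -
      interpret prob_space "open_loop M a s"
        by (rule prob_space_policy[OF s])
      show ?thesis
        using integrable_cost[OF s]
        by (simp add: policy_cost_def mean_cost_def ext_integral_eq_integral prob_space)
    qed
    have "\<bar>policy_cost (affine_mdp \<alpha> \<beta> M) (open_loop M a) s\<bar> \<le> ereal ((\<alpha> * C + \<bar>\<beta>\<bar>) * w s)"
      if s: "s \<in> states M" for s
    proof -
      have "\<bar>\<alpha> * mean_cost M (open_loop M a) s + \<beta>\<bar> \<le> \<alpha> * \<bar>mean_cost M (open_loop M a) s\<bar> + \<bar>\<beta>\<bar> * 1"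
        using assms abs_triangle_ineq[of "\<alpha> * mean_cost M (open_loop M a) s" \<beta>] by (simp add: abs_mult)
      also have "\<dots> \<le> \<alpha> * (C * w s) + \<bar>\<beta>\<bar> * w s"
        using C weight s assms by (intro add_mono mult_left_mono) auto
      finally show ?thesis
        by (simp add: eq[OF s] algebra_simps)
    qed
    moreover have "0 \<le> \<alpha> * C + \<bar>\<beta>\<bar>"
      using C assms by simp
    ultimately have "wnorm (states M) w (policy_cost (affine_mdp \<alpha> \<beta> M) (open_loop M a))
        \<le> ennreal (\<alpha> * C + \<bar>\<beta>\<bar>)"
      using weight_pos by (subst wnorm_le_iff) auto
    then have "wnorm (states M) w (policy_cost (affine_mdp \<alpha> \<beta> M) (open_loop M a)) < \<infinity>"
      by (rule le_less_trans) simp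
    then show "open_loop (affine_mdp \<alpha> \<beta> M) a \<in> stable_policies (affine_mdp \<alpha> \<beta> M) \<kappa> w"
      using stable by (simp add: stable_policies_def)
  qed
qed

lemma action_value_affine:
  assumes v: "weighted_fn M w v" and s: "s \<in> states M" and a: "a \<in> actions M"
  shows "action_value (affine_mdp \<alpha> \<beta> M) (\<lambda>x. \<alpha> * v x + \<delta>) s a
    = \<alpha> * action_value M v s a + (\<beta> + discount M * \<delta>)"
proof -
  interpret prob_space "kernel M (s, a)"
    by (rule prob_space_kernel[OF s a])
  show ?thesis
    using integrable_kernel[OF v s a] by (simp add: action_value_def prob_space algebra_simps)
qed

lemma action_value_add_const:
  assumes v: "weighted_fn M w v" and s: "s \<in> states M" and a: "a \<in> actions M"
  shows "action_value M (\<lambda>x. v x + \<delta>) s a = action_value M v s a + discount M * \<delta>"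
proof -
  interpret prob_space "kernel M (s, a)"
    by (rule prob_space_kernel[OF s a])
  show ?thesis
    using integrable_kernel[OF v s a] by (simp add: action_value_def prob_space algebra_simps)
qed

text \<open>
  The shift \<open>\<beta> / (1 - \<gamma>)\<close> is the total discounted value of the extra cost \<open>\<beta>\<close> per step: it is the
  solution of \<open>\<delta> = \<beta> + \<gamma> \<delta>\<close>.
\<close>

lemma optimality_equation_affine:
  assumes v: "weighted_fn M w v" "optimality_equation M v" and \<alpha>: "0 < \<alpha>"
  shows "optimality_equation (affine_mdp \<alpha> \<beta> M) (\<lambda>x. \<alpha> * v x + \<beta> / (1 - discount M))"
proof -
  have shift: "\<beta> + discount M * (\<beta> / (1 - discount M)) = \<beta> / (1 - discount M)"
    using discount_less_1 by (simp add: field_simps)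
  have affine: "action_value (affine_mdp \<alpha> \<beta> M) (\<lambda>x. \<alpha> * v x + \<beta> / (1 - discount M)) s a
      = \<alpha> * action_value M v s a + \<beta> / (1 - discount M)" if "s \<in> states M" "a \<in> actions M" for s a
    by (simp only: action_value_affine[OF v(1) that] shift)
  have "y \<le> \<alpha> * v s + \<beta> / (1 - discount M)"
    if s: "s \<in> states M" and y: "\<forall>a\<in>actions M. y \<le> \<alpha> * action_value M v s a + \<beta> / (1 - discount M)" for s y
  proof -
    have "\<forall>a\<in>actions M. (y - \<beta> / (1 - discount M)) / \<alpha> \<le> action_value M v s a"
      using y \<alpha> by (simp add: pos_divide_le_eq mult.commute le_diff_eq diff_le_eq)
    then have "(y - \<beta> / (1 - discount M)) / \<alpha> \<le> v s"
      using v(2) s by (auto simp: optimality_equation_def)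
    then show ?thesis
      using \<alpha> by (simp add: pos_divide_le_eq mult.commute diff_le_eq)
  qed
  moreover have "\<alpha> * v s \<le> \<alpha> * action_value M v s a" if "s \<in> states M" "a \<in> actions M" for s a
    using v(2) \<alpha> that by (simp add: optimality_equation_def)
  ultimately show ?thesis
    by (auto simp: optimality_equation_def affine)
qed

text \<open>
  Both bounds end with this estimate, for different functions \<open>v\<close>. Write \<open>y\<close> for the image of \<open>v\<close> under
  the affine map that the transformation induces on value functions. If the averages of \<open>q\<close> under the
  policy form \<open>u\<close>, then \<open>\<alpha>\<close> times the Bellman residual of \<open>v\<close> is the average of the
  transformed action values at \<open>y\<close> minus \<open>q\<close>, plus \<open>u - y\<close>. In the application \<open>q\<close> are the
  action values of the second model at its optimal value \<open>u\<close>, and the policy is greedy for them.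
\<close>

lemma value_fn_near_affine_preimage:
  assumes \<pi>: "\<pi> \<in> stable_policies M \<kappa> w" and v: "weighted_fn M w v" and \<alpha>: "0 < \<alpha>"
    and y: "\<forall>s\<in>states M. y s = \<alpha> * v s + \<beta> / (1 - discount M)"
    and q: "\<forall>s\<in>states M. integrable (\<pi> s) (q s) \<and> (\<integral>a. q s a \<partial>\<pi> s) = u s"
    and near_q: "\<forall>s\<in>states M. \<forall>a\<in>actions M. \<bar>action_value (affine_mdp \<alpha> \<beta> M) y s a - q s a\<bar> \<le> E * w s"
    and near_u: "\<forall>s\<in>states M. \<bar>u s - y s\<bar> \<le> F * w s"
    and nonneg: "0 \<le> E" "0 \<le> F" and s: "s \<in> states M"
  shows "\<bar>value_fn M \<pi> s - ereal (v s)\<bar> \<le> ereal ((E + F) / (\<alpha> * (1 - discount M * \<kappa>)) * w s)"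
proof -
  interpret stable_policy c_min M \<pi> \<kappa> w
    by (rule stable_policyI[OF \<pi>])
  let ?b = "\<beta> / (1 - discount M)"
  have shift: "\<beta> + discount M * ?b = ?b"
    using discount_less_1 by (simp add: field_simps)
  have affine: "action_value (affine_mdp \<alpha> \<beta> M) y x a = \<alpha> * action_value M v x a + ?b"
    if x: "x \<in> states M" and a: "a \<in> actions M" for x a
  proof -
    have "(\<integral>z. y z \<partial>kernel M (x, a)) = (\<integral>z. \<alpha> * v z + ?b \<partial>kernel M (x, a))"
      using y by (intro Bochner_Integration.integral_cong) (simp_all add: space_kernel[OF x a])
    then have "action_value (affine_mdp \<alpha> \<beta> M) y x a
        = action_value (affine_mdp \<alpha> \<beta> M) (\<lambda>z. \<alpha> * v z + ?b) x a"
      by (simp add: action_value_def)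
    then show ?thesis
      by (simp only: action_value_affine[OF v x a] shift)
  qed
  have residual: "\<bar>mean_cost M \<pi> x + discount M * (\<integral>z. v z \<partial>policy_kernel M \<pi> x) - v x\<bar>
      \<le> (E + F) / \<alpha> * w x" if x: "x \<in> states M" for x
  proof -
    interpret prob_space "\<pi> x"
      by (rule prob_space_policy[OF x])
    let ?r = "(\<integral>a. action_value M v x a \<partial>\<pi> x) - v x"
    let ?f = "\<lambda>a. \<alpha> * action_value M v x a + ?b - q x a"
    have int: "integrable (\<pi> x) ?f"
      using integrable_action_value[OF v \<pi> x] q x by simp
    have bounds: "- (E * w x) \<le> ?f a" "?f a \<le> E * w x" if "a \<in> space (\<pi> x)" for a
      using near_q x that affine[OF x, of a] by (force simp: space_policy[OF x] abs_le_iff)+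
    have "(\<integral>a. ?f a \<partial>\<pi> x) \<le> E * w x"
      using bounds by (intro integral_le_const[OF int] AE_I2) auto
    moreover have "- (E * w x) \<le> (\<integral>a. ?f a \<partial>\<pi> x)"
      using bounds by (intro integral_ge_const[OF int] AE_I2) auto
    moreover have "(\<integral>a. ?f a \<partial>\<pi> x) = \<alpha> * (\<integral>a. action_value M v x a \<partial>\<pi> x) + ?b - u x"
      using integrable_action_value[OF v \<pi> x] q x by (simp add: prob_space)
    moreover have "\<bar>u x - y x\<bar> \<le> F * w x" "y x = \<alpha> * v x + ?b"
      using near_u y x by auto
    ultimately have "\<bar>\<alpha> * ?r\<bar> \<le> (E + F) * w x"
      unfolding right_diff_distrib distrib_right by linarith
    moreover have "\<bar>\<alpha> * ?r\<bar> = \<alpha> * \<bar>?r\<bar>"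
      using \<alpha> by (simp add: abs_mult)
    ultimately have "\<bar>?r\<bar> \<le> (E + F) / \<alpha> * w x"
      using \<alpha> by (simp add: pos_le_divide_eq mult.commute)
    then show ?thesis
      by (simp only: integral_action_value[OF v \<pi> x])
  qed
  have "v \<in> borel_measurable (state_space M)"
    using v by (simp add: weighted_fn_def)
  moreover obtain C where "\<forall>x\<in>states M. \<bar>v x\<bar> \<le> C * w x" "0 \<le> C"
    using v unfolding weighted_fn_def by blast
  moreover have "0 \<le> (E + F) / \<alpha>"
    using nonneg \<alpha> by simp
  ultimately have "\<bar>value_fn M \<pi> s - ereal (v s)\<bar> \<le> ereal ((E + F) / \<alpha> / (1 - discount M * \<kappa>) * w s)"
    using value_fn_near_approximate_fixed_point[of v C "(E + F) / \<alpha>" s] residual s by blast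
  then show ?thesis
    by (simp add: divide_divide_eq_left)
qed

end

section \<open>Bounds by the Bellman mismatch\<close>

lemma mismatch_max_le_iff:
  assumes N: "stable_mdp c (affine_mdp \<alpha>1 \<alpha>2 M) \<kappa> w" and N': "stable_mdp c' M' \<kappa> w"
    and same: "states M' = states M" "actions M' = actions M"
    and v: "weighted_fn M w v" and V: "\<forall>s\<in>states M. V s = ereal (v s)" and D: "0 \<le> D"
  shows "mismatch_max M M' w \<alpha>1 \<alpha>2 V \<le> ennreal D \<longleftrightarrow>
    (\<forall>s\<in>states M. \<forall>a\<in>actions M.
      \<bar>action_value (affine_mdp \<alpha>1 \<alpha>2 M) v s a - action_value M' v s a\<bar> \<le> D * w s)"
proof -
  interpret N: stable_mdp c "affine_mdp \<alpha>1 \<alpha>2 M" \<kappa> w by fact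
  interpret N': stable_mdp c' M' \<kappa> w by fact
  have w: "\<forall>s\<in>states M. 0 < w s"
    using N.weight_pos by simp
  have v': "weighted_fn M' w v"
    using v by (simp add: weighted_fn_def same state_space_def)
  have same_policy: "open_loop M' = open_loop M"
    by (simp add: open_loop_def action_space_def same fun_eq_iff)
  have "bellman (affine_mdp \<alpha>1 \<alpha>2 M) (open_loop M a) V s - bellman M' (open_loop M a) V s
      = ereal (action_value (affine_mdp \<alpha>1 \<alpha>2 M) v s a - action_value M' v s a)"
    if "s \<in> states M" "a \<in> actions M" for s a
    using N.bellman_open_loop[of v V s a] N'.bellman_open_loop[OF v', of V s a] v V that
    by (simp add: same same_policy)
  then show ?thesis
    unfolding mismatch_max_def SUP_le_iff wnorm_le_iff[OF w D] by auto
qed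

theorem theorem4:
  fixes M M' :: "('s::polish_space, 'a::polish_space) mdp"
    and c_min \<kappa> \<alpha>1 \<alpha>2 :: real
    and w :: "'s \<Rightarrow> real"
    and Vopt Vopt' :: "'s \<Rightarrow> ereal"
    and \<pi>' :: "'s \<Rightarrow> 'a measure"
  assumes "is_mdp c_min M" and "is_mdp c_min M'"
    and "states M' = states M" and "actions M' = actions M" and "discount M' = discount M"
    and "\<forall>s\<in>states M. 1 \<le> w s"
    and "0 < \<kappa>" and "discount M * \<kappa> < 1"
    and "0 < \<alpha>1"
    and "DP_solvable c_min M w" and "DP_solvable c_min M' w"
    and "is_opt_value c_min M w Vopt" and "is_opt_value c_min M' w Vopt'"
    and "greedy M Vopt \<inter> stable_policies M \<kappa> w \<noteq> {}"
    and "greedy M' Vopt' \<inter> stable_policies M \<kappa> w \<inter> stable_policies M' \<kappa> w \<noteq> {}"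
    and "\<forall>a\<in>actions M. open_loop M a \<in> stable_policies M \<kappa> w \<inter> stable_policies M' \<kappa> w"
    and "greedy M Vopt' \<noteq> {}" and "greedy M' Vopt \<noteq> {}"
    and "\<pi>' \<in> greedy M' Vopt' \<inter> stable_policies M \<kappa> w \<inter> stable_policies M' \<kappa> w"
  shows "wnorm (states M) w (\<lambda>s. value_fn M \<pi>' s - Vopt s)
           \<le> ennreal (2 / (\<alpha>1 * (1 - discount M * \<kappa>))) * mismatch_max M M' w \<alpha>1 \<alpha>2 Vopt'
       \<and> wnorm (states M) w (\<lambda>s. value_fn M \<pi>' s - Vopt s)
           \<le> ennreal (2 / (\<alpha>1 * (1 - discount M * \<kappa>)\<^sup>2))
               * mismatch_max M M' w \<alpha>1 \<alpha>2 (\<lambda>s. ereal \<alpha>1 * Vopt s)"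
proof -
  note same = assms(3-5) and weight = assms(6) and \<alpha>1 = assms(9)
  have same_policy: "open_loop M' = open_loop M"
    by (simp add: open_loop_def action_space_def same fun_eq_iff)
  have same_fn: "weighted_fn M' w = weighted_fn M w"
    by (simp add: weighted_fn_def[abs_def] state_space_def same)
  interpret M: stable_mdp c_min M \<kappa> w
    using assms by unfold_locales auto
  interpret M': stable_mdp c_min M' \<kappa> w
    using assms by unfold_locales (auto simp: same_policy)
  let ?N = "affine_mdp \<alpha>1 \<alpha>2 M" and ?\<rho> = "1 - discount M * \<kappa>" and ?b = "\<alpha>2 / (1 - discount M)"
  interpret N: stable_mdp "\<alpha>1 * c_min + \<alpha>2" ?N \<kappa> w
    by (rule M.stable_mdp_affine[OF \<alpha>1])
  have \<rho>: "0 < ?\<rho>"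
    using M.contraction by simp
  have w_pos: "\<forall>s\<in>states M. 0 < w s"
    using M.weight_pos by blast
  obtain v where v: "weighted_fn M w v" "\<forall>s\<in>states M. Vopt s = ereal (v s)"
    "\<forall>s\<in>states M. Vopt s = bellman_opt M Vopt s"
    by (rule opt_valueE[OF assms(12) weight])
  obtain v' where v': "weighted_fn M' w v'" "\<forall>s\<in>states M'. Vopt' s = ereal (v' s)"
    "\<forall>s\<in>states M'. Vopt' s = bellman_opt M' Vopt' s"
    by (rule opt_valueE[OF assms(13) M'.weight])
  have v'_fn: "weighted_fn M w v'"
    using v'(1) by (simp add: same_fn)
  have v_opt: "optimality_equation M v"
    by (rule M.bellman_opt_imp_optimality_equation[OF v])
  have v'_opt: "optimality_equation M' v'"
    by (rule M'.bellman_opt_imp_optimality_equation[OF v'])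
  define u where "u = (\<lambda>s. \<alpha>1 * v s + ?b)"
  have u: "weighted_fn M w u" "optimality_equation ?N u"
    unfolding u_def by (rule weighted_fn_affine[OF v(1) weight], rule M.optimality_equation_affine[OF v(1) v_opt \<alpha>1])
  have \<pi>'_M: "\<pi>' \<in> stable_policies M \<kappa> w" and \<pi>'_M': "\<pi>' \<in> stable_policies M' \<kappa> w"
    and \<pi>'_greedy: "\<pi>' \<in> greedy M' Vopt'"
    using assms(19) by auto
  have q: "\<forall>s\<in>states M. integrable (\<pi>' s) (action_value M' v' s) \<and> (\<integral>a. action_value M' v' s a \<partial>\<pi>' s) = v' s"
  proof
    fix s assume "s \<in> states M"
    then have s: "s \<in> states M'"
      by (simp add: same)
    have "ereal (v' s) = bellman M' \<pi>' Vopt' s"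
      using v'(2,3) \<pi>'_greedy s by (simp add: greedy_def)
    also have "\<dots> = ereal (\<integral>a. action_value M' v' s a \<partial>\<pi>' s)"
      by (simp add: stable_policy.bellman_eq[OF M'.stable_policyI[OF \<pi>'_M'] v'(1,2) s]
          M'.integral_action_value[OF v'(1) \<pi>'_M' s])
    finally show "integrable (\<pi>' s) (action_value M' v' s) \<and> (\<integral>a. action_value M' v' s a \<partial>\<pi>' s) = v' s"
      using M'.integrable_action_value[OF v'(1) \<pi>'_M' s] by simp
  qed

  \<comment> \<open>The residual estimate is applied at the preimage \<open>x\<close> of \<open>v'\<close> under the affine map, where the
    residual is the mismatch alone; the distance of \<open>x\<close> to \<open>v\<close> costs as much again.\<close>
  have bound1: "wnorm (states M) w (\<lambda>s. value_fn M \<pi>' s - Vopt s) \<le> ennreal (2 / (\<alpha>1 * ?\<rho>)) * ennreal D"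
    if D: "0 \<le> D" "mismatch_max M M' w \<alpha>1 \<alpha>2 Vopt' = ennreal D" for D
  proof -
    have near: "\<forall>s\<in>states M. \<forall>a\<in>actions M. \<bar>action_value ?N v' s a - action_value M' v' s a\<bar> \<le> D * w s"
      using mismatch_max_le_iff[OF N.stable_mdp_axioms M'.stable_mdp_axioms same(1,2) v'_fn _ D(1),
          where V = Vopt'] v'(2) D(2)
      by (simp add: same)
    have dist: "\<forall>s\<in>states M. \<bar>u s - v' s\<bar> \<le> D / ?\<rho> * w s"
      using optimal_values_distance[OF N.stable_mdp_axioms M'.stable_mdp_axioms, of u v' D]
        u v'_fn v'_opt near D(1) by (simp add: same)
    define x where "x = (\<lambda>s. 1 / \<alpha>1 * v' s + - (?b / \<alpha>1))"
    have x: "weighted_fn M w x"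
      unfolding x_def by (rule weighted_fn_affine[OF v'_fn weight])
    have v'_eq: "\<forall>s\<in>states M. v' s = \<alpha>1 * x s + ?b"
    proof
      fix s
      have inverse: "y = \<alpha>1 * (1 / \<alpha>1 * y + - (b / \<alpha>1)) + b" for y b
        using \<alpha>1 by (simp add: field_simps)
      show "v' s = \<alpha>1 * x s + ?b"
        unfolding x_def by (rule inverse)
    qed
    have "\<bar>value_fn M \<pi>' s - Vopt s\<bar> \<le> ereal (2 / (\<alpha>1 * ?\<rho>) * D * w s)" if s: "s \<in> states M" for s
    proof -
      have "\<bar>value_fn M \<pi>' s - ereal (x s)\<bar> \<le> ereal ((D + 0) / (\<alpha>1 * ?\<rho>) * w s)"
        using near D(1) by (intro M.value_fn_near_affine_preimage[OF \<pi>'_M x \<alpha>1 v'_eq q _ _ _ _ s]) auto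
      then obtain r where r: "value_fn M \<pi>' s = ereal r" "\<bar>r - x s\<bar> \<le> D / (\<alpha>1 * ?\<rho>) * w s"
        by (cases "value_fn M \<pi>' s") auto
      have "\<alpha>1 * (x s - v s) = v' s - u s"
        using v'_eq s by (simp add: u_def algebra_simps)
      then have "\<alpha>1 * \<bar>x s - v s\<bar> \<le> D / ?\<rho> * w s"
        using dist s \<alpha>1 by (metis abs_minus_commute abs_mult abs_of_pos)
      then have "\<bar>x s - v s\<bar> \<le> D / ?\<rho> * w s / \<alpha>1"
        using \<alpha>1 by (simp only: pos_le_divide_eq mult.commute)
      also have "\<dots> = D / (\<alpha>1 * ?\<rho>) * w s"
        by simp
      finally have "\<bar>x s - v s\<bar> \<le> D / (\<alpha>1 * ?\<rho>) * w s" .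
      with r(2) have "\<bar>r - v s\<bar> \<le> D / (\<alpha>1 * ?\<rho>) * w s + D / (\<alpha>1 * ?\<rho>) * w s"
        by linarith
      then show ?thesis
        using v(2) s r(1) by simp
    qed
    then have "wnorm (states M) w (\<lambda>s. value_fn M \<pi>' s - Vopt s) \<le> ennreal (2 / (\<alpha>1 * ?\<rho>) * D)"
      using \<alpha>1 \<rho> D(1) by (subst wnorm_le_iff[OF w_pos]) auto
    then show ?thesis
      using \<alpha>1 \<rho> D(1) by (simp add: ennreal_mult[symmetric])
  qed

  \<comment> \<open>The residual estimate is applied at \<open>v\<close> itself. The policy is greedy at \<open>v'\<close>, whereas the
    mismatch is known at \<open>u\<close>; passing between the two costs errors proportional to their distance
    \<open>D / (1 - \<gamma> \<kappa>)\<close>, which produces the second factor \<open>1 - \<gamma> \<kappa>\<close>.\<close>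
  have bound2: "wnorm (states M) w (\<lambda>s. value_fn M \<pi>' s - Vopt s) \<le> ennreal (2 / (\<alpha>1 * ?\<rho>\<^sup>2)) * ennreal D"
    if D: "0 \<le> D" "mismatch_max M M' w \<alpha>1 \<alpha>2 (\<lambda>s. ereal \<alpha>1 * Vopt s) = ennreal D" for D
  proof -
    have scaled: "weighted_fn M w (\<lambda>s. \<alpha>1 * v s)"
      using weighted_fn_affine[OF v(1) weight, of \<alpha>1 0] by simp
    have "\<forall>s\<in>states M. \<forall>a\<in>actions M.
        \<bar>action_value ?N (\<lambda>s. \<alpha>1 * v s) s a - action_value M' (\<lambda>s. \<alpha>1 * v s) s a\<bar> \<le> D * w s"
      using mismatch_max_le_iff[OF N.stable_mdp_axioms M'.stable_mdp_axioms same(1,2) scaled _ D(1),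
          where V = "\<lambda>s. ereal \<alpha>1 * Vopt s"] v(2) D(2)
      by simp
    \<comment> \<open>Both models discount by the same factor, so adding a constant leaves the mismatch unchanged.\<close>
    then have near: "\<forall>s\<in>states M. \<forall>a\<in>actions M. \<bar>action_value ?N u s a - action_value M' u s a\<bar> \<le> D * w s"
      using N.action_value_add_const[of "\<lambda>s. \<alpha>1 * v s"] M'.action_value_add_const[of "\<lambda>s. \<alpha>1 * v s"] scaled
      by (simp add: u_def same same_fn)
    have dist: "\<forall>s\<in>states M. \<bar>v' s - u s\<bar> \<le> D / ?\<rho> * w s"
      using optimal_values_distance[OF M'.stable_mdp_axioms N.stable_mdp_axioms, of v' u D]
        u v'_fn v'_opt near D(1) by (simp add: same same_fn abs_minus_commute)
    let ?E = "D + discount M * \<kappa> * (D / ?\<rho>)"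
    have near': "\<bar>action_value ?N u s a - action_value M' v' s a\<bar> \<le> ?E * w s"
      if s: "s \<in> states M" and a: "a \<in> actions M" for s a
    proof -
      have "\<bar>action_value M' v' s a - action_value M' u s a\<bar> \<le> discount M * \<kappa> * (D / ?\<rho>) * w s"
        using M'.action_value_lipschitz[of v' u "D / ?\<rho>" s a] u(1) v'_fn dist D(1) \<rho> s a
        by (simp add: same same_fn)
      moreover have "\<bar>action_value ?N u s a - action_value M' u s a\<bar> \<le> D * w s"
        using near s a by blast
      ultimately show ?thesis
        unfolding distrib_right by linarith
    qed
    have sum: "(?E + D / ?\<rho>) / (\<alpha>1 * ?\<rho>) = 2 / (\<alpha>1 * ?\<rho>\<^sup>2) * D"
    proof -
      have "\<delta> * (1 - k) + k * \<delta> + \<delta> = 2 * \<delta>" for \<delta> k :: real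
        by (simp add: algebra_simps)
      moreover have "D / ?\<rho> * ?\<rho> = D"
        using \<rho> by simp
      ultimately have "?E + D / ?\<rho> = 2 * (D / ?\<rho>)"
        by metis
      then show ?thesis
        by (simp add: power2_eq_square)
    qed
    have "\<bar>value_fn M \<pi>' s - Vopt s\<bar> \<le> ereal (2 / (\<alpha>1 * ?\<rho>\<^sup>2) * D * w s)" if s: "s \<in> states M" for s
    proof -
      have "\<bar>value_fn M \<pi>' s - ereal (v s)\<bar> \<le> ereal ((?E + D / ?\<rho>) / (\<alpha>1 * ?\<rho>) * w s)"
      proof (rule M.value_fn_near_affine_preimage[OF \<pi>'_M v(1) \<alpha>1 _ q _ _ _ _ s])
        show "\<forall>s\<in>states M. u s = \<alpha>1 * v s + ?b"
          by (simp add: u_def)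
        show "0 \<le> ?E" "0 \<le> D / ?\<rho>"
          using D(1) \<rho> M.discount_pos M.\<kappa>_pos by simp_all
      qed (use near' dist in auto)
      then show ?thesis
        by (simp only: sum bspec[OF v(2) s])
    qed
    then have "wnorm (states M) w (\<lambda>s. value_fn M \<pi>' s - Vopt s) \<le> ennreal (2 / (\<alpha>1 * ?\<rho>\<^sup>2) * D)"
      using \<alpha>1 \<rho> D(1) by (subst wnorm_le_iff[OF w_pos]) auto
    then show ?thesis
      using \<alpha>1 \<rho> D(1) by (simp add: ennreal_mult[symmetric])
  qed

  have le_top: "x \<le> ennreal k * m" if "0 < k" "\<And>D. 0 \<le> D \<Longrightarrow> m = ennreal D \<Longrightarrow> x \<le> ennreal k * ennreal D"
    for x m :: ennreal and k
    using that by (cases m) (auto simp: ennreal_mult_top)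
  have "0 < 2 / (\<alpha>1 * ?\<rho>)" "0 < 2 / (\<alpha>1 * ?\<rho>\<^sup>2)"
    using \<alpha>1 \<rho> by simp_all
  from this(1)[THEN le_top, OF bound1] this(2)[THEN le_top, OF bound2] show ?thesis
    by (rule conjI)
qed

end
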